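(* Let $k\ge 1$ be an integer and let $f,g$ be polynomials in one variable with integer coefficients. Define the map $F:\mathbb{Z}^2\to\mathbb{Z}$ by $$F(x,y)=f(x)+x^k g(y).$$ Assume moreover that $f(x)$ is affinely independent to $x^k$, i.e. there is no $(u,v)\in\mathbb{Z}^2$ such that $f(x)=u x^k+v$ or $x^k=u f(x)+v$ (as polynomials). Then $F$ induces an expander (in two variables).
   Context: For a prime $p$, $\mathbb{F}_p$ is the field with $p$ elements. A polynomial $F$ with integer coefficients in $k$ variables induces, for every prime $p$, a map $F_p:\mathbb{F}_p^k\to\mathbb{F}_p$ by reduction modulo $p$. For subsets $A_1,\dots,A_k$ of $\mathbb{F}_p$, put $F_p(A_1,\dots,A_k)=\{F_p(a_1,\dots,a_k): a_i\in A_i,\ 1\le i\le k\}$. A family of maps $(F_p)_p$ ($p$ running over the primes, $F_p:\mathbb{F}_p^k\to\mathbb{F}_p$) is an expander (in $k$ variables) if for every $\alpha$ with $0<\alpha<1$ there exists $\epsilon=\epsilon(\alpha)>0$, such that for any positive real numbers $L_1\le L_2$ there is a constant $c=c(F,L_1,L_2)>0$, not depending on $\alpha$, with the following property: for every prime $p$ and all subsets $A_1,\dots,A_k$ of $\mathbb{F}_p$ satisfying $L_1p^{\alpha}\le |A_i|\le L_2p^{\alpha}$ ($1\le i\le k$), one has $|F_p(A_1,\dots,A_k)|\ge c\,p^{\alpha+\epsilon}$. One says that an integer polynomial $F$ induces an expander if the induced family $(F_p)_p$ is an expander.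
   Formalization: The polynomial g is additionally assumed to be non-constant; for every constant g the map F depends only on x, so |F_p(A_1,A_2)| ≤ |A_1| and the claim is false (e.g. k = 1, f = x², g = 0). *)

theory Defs
  imports "HOL-Number_Theory.Residues" "HOL-Computational_Algebra.Polynomial" Complex_Main
begin

text \<open>
  The field with \<open>p\<close> elements is the carrier \<open>{0..p - 1}\<close> of \<^const>\<open>residue_ring\<close>. An
  \<open>n\<close>-tuple is a function on the index set \<open>{..<n}\<close>, so that \<open>A\<^sub>0 \<times> \<dots> \<times> A\<^bsub>n-1\<^esub>\<close> is
  \<open>Pi\<^sub>E {..<n} A\<close>.

  The exponent gain is a function \<open>\<epsilon>\<close> of \<open>\<alpha>\<close> chosen before \<open>L\<^sub>1\<close> and \<open>L\<^sub>2\<close>, whereas the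
  constant \<open>c\<close> may depend on \<open>L\<^sub>1\<close> and \<open>L\<^sub>2\<close> but serves every \<open>\<alpha>\<close> at once.
\<close>

definition expander :: "nat \<Rightarrow> (nat \<Rightarrow> (nat \<Rightarrow> int) \<Rightarrow> int) \<Rightarrow> bool" where
  "expander n Fs \<longleftrightarrow>
    (\<exists>\<epsilon> :: real \<Rightarrow> real.
      (\<forall>\<alpha>. 0 < \<alpha> \<and> \<alpha> < 1 \<longrightarrow> \<epsilon> \<alpha> > 0) \<and>
      (\<forall>L1 L2 :: real. 0 < L1 \<and> L1 \<le> L2 \<longrightarrow>
        (\<exists>c :: real. c > 0 \<and>
          (\<forall>\<alpha>. 0 < \<alpha> \<and> \<alpha> < 1 \<longrightarrow>
            (\<forall>p :: nat. prime p \<longrightarrow>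
              (\<forall>A :: nat \<Rightarrow> int set.
                (\<forall>i<n. A i \<subseteq> carrier (residue_ring (int p)) \<and>
                       L1 * real p powr \<alpha> \<le> real (card (A i)) \<and>
                       real (card (A i)) \<le> L2 * real p powr \<alpha>) \<longrightarrow>
                real (card (Fs p ` Pi\<^sub>E {..<n} A)) \<ge> c * real p powr (\<alpha> + \<epsilon> \<alpha>)))))))"

text \<open>
  For \<open>F\<close> given by an integer polynomial, \<open>F a mod p\<close> depends only on the residues of the
  coordinates of \<open>a\<close>, so the following evaluation on the representatives \<open>0, \<dots>, p - 1\<close> is
  the map induced by \<open>F\<close> on \<open>n\<close>-tuples over the field with \<open>p\<close> elements.
\<close>

definition induced_map :: "((nat \<Rightarrow> int) \<Rightarrow> int) \<Rightarrow> nat \<Rightarrow> (nat \<Rightarrow> int) \<Rightarrow> int" where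
  "induced_map F p = (\<lambda>a. F a mod int p)"

definition induces_expander :: "nat \<Rightarrow> ((nat \<Rightarrow> int) \<Rightarrow> int) \<Rightarrow> bool" where
  "induces_expander n F \<longleftrightarrow> expander n (induced_map F)"

definition affinely_independent :: "int poly \<Rightarrow> int poly \<Rightarrow> bool" where
  "affinely_independent f h \<longleftrightarrow>
    \<not> (\<exists>u v :: int. f = smult u h + [:v:] \<or> h = smult u f + [:v:])"

lemma poly_cong_int:
  fixes f :: "int poly"
  assumes "[x = y] (mod m)"
  shows "[poly f x = poly f y] (mod m)"
  by (induction f) (auto intro!: cong_add cong_mult assms)

lemma induced_map_two_var_cong:
  fixes f g :: "int poly" and k :: nat
  defines "F \<equiv> \<lambda>a :: nat \<Rightarrow> int. poly f (a 0) + a 0 ^ k * poly g (a 1)"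
  assumes "[a 0 = b 0] (mod int p)" and "[a 1 = b 1] (mod int p)"
  shows "induced_map F p a = induced_map F p b"
proof -
  have "[F a = F b] (mod int p)"
    unfolding F_def
    by (intro cong_add cong_mult cong_pow poly_cong_int assms)
  thus ?thesis by (simp add: induced_map_def cong_def)
qed

text \<open>
  A map of two variables that only depends on the first one takes at most \<open>|A\<^sub>0|\<close> values and
  never induces an expander. In particular, \<open>f(x) + x\<^sup>k g(y)\<close> does not if \<open>g\<close> is constant,
  whatever \<open>f\<close> is.
\<close>

lemma not_induces_expander_one_variable:
  assumes F: "\<And>a. F a = h (a 0)"
  shows "\<not> induces_expander 2 F"
proof
  assume "induces_expander 2 F"
  then obtain \<epsilon> :: "real \<Rightarrow> real" where
    e: "\<forall>\<alpha>. 0 < \<alpha> \<and> \<alpha> < 1 \<longrightarrow> \<epsilon> \<alpha> > 0" and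
    *: "\<forall>L1 L2 :: real. 0 < L1 \<and> L1 \<le> L2 \<longrightarrow>
        (\<exists>c :: real. c > 0 \<and>
          (\<forall>\<alpha>. 0 < \<alpha> \<and> \<alpha> < 1 \<longrightarrow>
            (\<forall>p :: nat. prime p \<longrightarrow>
              (\<forall>A :: nat \<Rightarrow> int set.
                (\<forall>i<2. A i \<subseteq> carrier (residue_ring (int p)) \<and>
                       L1 * real p powr \<alpha> \<le> real (card (A i)) \<and>
                       real (card (A i)) \<le> L2 * real p powr \<alpha>) \<longrightarrow>
                real (card (induced_map F p ` Pi\<^sub>E {..<2} A)) \<ge> c * real p powr (\<alpha> + \<epsilon> \<alpha>)))))"
    unfolding induces_expander_def expander_def by blast
  define d where "d = \<epsilon> (1/2)"
  have d: "d > 0" using e by (simp add: d_def)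
  from *[rule_format, of 1 2] obtain c :: real where c: "c > 0" and
    **: "\<And>p A. prime p \<Longrightarrow>
          \<forall>i<2. A i \<subseteq> carrier (residue_ring (int p)) \<and>
             1 * real p powr (1/2) \<le> real (card (A i)) \<and>
             real (card (A i)) \<le> 2 * real p powr (1/2) \<Longrightarrow>
          real (card (induced_map F p ` Pi\<^sub>E {..<2} A)) \<ge> c * real p powr (1/2 + \<epsilon> (1/2))"
    by fastforce
  obtain p :: nat where p: "prime p" "p > nat \<lceil>(2 / c) powr (1 / d)\<rceil>"
    using bigger_prime by blast
  have p_gt: "real p > (2 / c) powr (1 / d)" using p(2) by linarith
  have p1: "1 < real p" using prime_gt_1_nat[OF p(1)] by simp
  define m where "m = nat \<lceil>real p powr (1/2)\<rceil>"
  define A :: "nat \<Rightarrow> int set" where "A = (\<lambda>_. {0..<int m})"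
  have q1: "1 \<le> real p powr (1/2)" using p1 by (simp add: ge_one_powr_ge_zero)
  have m: "real p powr (1/2) \<le> real m" "real m \<le> 2 * real p powr (1/2)"
    using q1 unfolding m_def by linarith+
  have "real p powr (1/2) \<le> real p powr 1" using p1 by (intro powr_mono) auto
  hence "m \<le> p" using p1 unfolding m_def by (simp add: ceiling_le_iff)
  hence "c * real p powr (1/2 + d) \<le> real (card (induced_map F p ` Pi\<^sub>E {..<2} A))"
    unfolding d_def using p(1) m by (intro **) (auto simp: A_def residue_ring_def)
  also have "induced_map F p ` Pi\<^sub>E {..<2} A \<subseteq> (\<lambda>x. h x mod int p) ` {0..<int m}"
    by (auto simp: induced_map_def F A_def PiE_iff)
  hence "card (induced_map F p ` Pi\<^sub>E {..<2} A) \<le> card {0..<int m}"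
    by (meson card_image_le card_mono finite_atLeastLessThan_int finite_imageI order_trans)
  hence "real (card (induced_map F p ` Pi\<^sub>E {..<2} A)) \<le> 2 * real p powr (1/2)"
    using m by simp
  finally have "real p powr (1/2) * (c * real p powr d) \<le> real p powr (1/2) * 2"
    by (simp add: powr_add mult_ac)
  hence "c * real p powr d \<le> 2" using q1 p1 by (subst (asm) mult_le_cancel_left_pos) auto
  moreover have "((2 / c) powr (1 / d)) powr d < real p powr d"
    using p_gt d by (intro powr_less_mono2) auto
  hence "2 / c < real p powr d" using c d by (simp add: powr_powr)
  hence "2 < c * real p powr d" using c by (simp add: field_simps)
  ultimately show False by linarith
qed

corollary not_induces_expander_const:
  fixes f :: "int poly" and b :: int
  shows "\<not> induces_expander 2 (\<lambda>a. poly f (a 0) + a 0 ^ k * poly [:b:] (a 1))"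
  by (rule not_induces_expander_one_variable[where h = "\<lambda>x. poly f x + x ^ k * b"]) simp

end

theory Submission
  imports Defs "HOL-Library.Set_Algebras" "HOL-Analysis.Convex"
begin

text \<open>
  Fix a prime \<open>p\<close>, put \<open>N = p\<^sup>\<alpha>\<close>, and suppose that the image \<open>U\<close> of \<open>A \<times> B\<close> has only \<open>K N\<close> elements. Each
  affine map \<open>\<phi>\<^sub>x(y) = f(x) + x\<^sup>k y\<close> with \<open>x\<close> in \<open>A - {0}\<close> sends the set \<open>Y = g(B)\<close>, which has about \<open>N\<close>
  elements, into \<open>U\<close>. A small \<open>U\<close> alone is not contradictory, since the maps could be translates of
  one another, or could all send one point to the same point. This is where affine independence is
  used: \<open>f\<close> has a monomial different from \<open>1\<close> and \<open>x\<^sup>k\<close>, and therefore the composites \<open>\<phi>\<^bsub>x'\<^esub> \<circ> \<phi>\<^sub>x\<^sup>-\<^sup>1\<close> form about \<open>N\<^sup>2\<close> distinct affine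
  maps (\<open>card_coincident_lines_le\<close>), each of which carries about \<open>N\<close> points of \<open>U\<close> to \<open>U\<close>.

  That so many affine maps almost preserve \<open>U\<close> contradicts the sum-product phenomenon, by the following
  argument, in which every step loses a fixed power of \<open>K\<close>. Affine maps are determined by their values at two
  points \<open>u, u'\<close> of \<open>U\<close> and respect affine relations between \<open>u, u'\<close> and a third point; so the composites
  exhibit, for many \<open>s\<close>, a dense set of pairs \<open>(v, v')\<close> in \<open>U \<times> U\<close> for which \<open>v + s v'\<close> takes few
  values (\<open>rich_ratios\<close>). The Balog-Szemeredi-Gowers theorem and the triangle inequality for sumsets extract
  from this a set \<open>X\<close> of size about \<open>N\<close> and about \<open>N\<close> elements \<open>r\<close> for which \<open>X + r X\<close> is hardly larger than
  \<open>X\<close> (\<open>dense_dilate_graphs\<close>). The elements \<open>r\<close> with this property are closed under a bounded number of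
  field operations, which produces about \<open>N\<^sup>2\<close> of them or all of the field (\<open>pivot\<close>), whereas an
  elementary count permits only about \<open>N\<close> (\<open>few_good\<close>).

  The outcome is that \<open>|U| \<le> K\<^sup>C\<close> or \<open>p \<le> K\<^sup>C |U|\<close> for an absolute constant \<open>C\<close>
  (\<open>affine_family_growth\<close>). For \<open>N = p\<^sup>\<alpha>\<close> the first forces \<open>K\<close> to be at least of order \<open>p\<^bsup>\<alpha>/C\<^esup>\<close>, and
  the second at least of order \<open>p\<^bsup>(1-\<alpha>)/(C+1)\<^esup>\<close>. Hence \<open>\<epsilon> = min \<alpha> (1 - \<alpha>) / (C + 1)\<close> works for
  every \<open>\<alpha>\<close> between \<open>0\<close> and \<open>1\<close>, with a constant that is uniform in \<open>\<alpha>\<close>.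
\<close>

section \<open>Counting\<close>

text \<open>
  The form in which popularity arguments use double counting: an upper bound on the size of a set whose
  elements all have many representations.
\<close>

lemma card_fibres_le:
  fixes r :: real
  assumes "finite Z"
    and "\<And>d. d \<in> D \<Longrightarrow> \<exists>(C :: 'c set) \<iota>. r \<le> real (card C) \<and> inj_on \<iota> C \<and> \<iota> ` C \<subseteq> {z \<in> Z. h z = d}"
  shows "real (card D) * r \<le> real (card Z)"
proof (cases "finite D")
  case True
  have "r \<le> real (card {z \<in> Z. h z = d})" if d: "d \<in> D" for d
  proof -
    obtain C :: "'c set" and \<iota> where "r \<le> real (card C)" "inj_on \<iota> C" "\<iota> ` C \<subseteq> {z \<in> Z. h z = d}"
      using assms(2)[OF d] by blast
    moreover from this have "card C \<le> card {z \<in> Z. h z = d}"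
      using assms(1) by (intro card_inj_on_le) auto
    ultimately show ?thesis by linarith
  qed
  hence "real (card D) * r \<le> (\<Sum>d\<in>D. real (card {z \<in> Z. h z = d}))"
    by (rule sum_bounded_below)
  also have "\<dots> = real (card (\<Union>d\<in>D. {z \<in> Z. h z = d}))"
    using assms(1) True by (subst card_UN_disjoint) auto
  also have "\<dots> \<le> real (card Z)"
    using assms(1) by (intro of_nat_mono card_mono) auto
  finally show ?thesis .
qed simp

lemma double_count:
  assumes "finite S" "finite T"
  shows "(\<Sum>i\<in>S. real (card {j \<in> T. R i j})) = (\<Sum>j\<in>T. real (card {i \<in> S. R i j}))"
  using sum_multicount_gen[OF assms, where k = "\<lambda>j. card {i \<in> S. R i j}" and R = R]
  by (simp flip: of_nat_sum)

lemma exists_ge_average: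
  fixes f :: "'i \<Rightarrow> real"
  assumes "finite B" "real (card B) \<le> M" "0 < s" "s \<le> (\<Sum>b\<in>B. f b)"
  shows "\<exists>b\<in>B. s / M \<le> f b"
proof (rule ccontr)
  assume "\<not> ?thesis"
  hence less: "f b < s / M" if "b \<in> B" for b using that by force
  have "B \<noteq> {}" using assms by auto
  hence M: "0 < M" using assms card_gt_0_iff[of B] by linarith
  have "(\<Sum>b\<in>B. f b) < (\<Sum>b\<in>B. s / M)"
    using less \<open>B \<noteq> {}\<close> assms(1) by (intro sum_strict_mono) auto
  also have "\<dots> \<le> M * (s / M)"
    using assms M by (simp add: field_simps)
  finally show False using assms M by simp
qed

lemma sum_square_le:
  fixes f :: "'i \<Rightarrow> real"
  assumes "real (card B) \<le> M"
  shows "(\<Sum>b\<in>B. f b)\<^sup>2 \<le> M * (\<Sum>b\<in>B. (f b)\<^sup>2)"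
proof -
  have "(\<Sum>b\<in>B. f b)\<^sup>2 \<le> real (card B) * (\<Sum>b\<in>B. (f b)\<^sup>2)"
    using Cauchy_Schwarz_ineq_sum[of "\<lambda>_. 1" f B] by simp
  also have "\<dots> \<le> M * (\<Sum>b\<in>B. (f b)\<^sup>2)"
    by (intro mult_right_mono assms sum_nonneg) auto
  finally show ?thesis .
qed

section \<open>Sumsets\<close>

lemma card_set_plus_le:
  fixes A B :: "'a::ab_group_add set"
  assumes "finite A" "finite B"
  shows "card (A + B) \<le> card A * card B"
proof -
  have "A + B = (\<lambda>(a, b). a + b) ` (A \<times> B)" by (auto simp: set_plus_def)
  thus ?thesis using card_image_le[of "A \<times> B" "\<lambda>(a, b). a + b"] assms
    by (simp add: card_cartesian_product)
qed

text \<open>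
  For \<open>x = a + c\<close> fixed, \<open>b \<mapsto> (a + b, c - b)\<close> injects \<open>B\<close> into the pairs with sum \<open>x\<close>. This is the
  triangle inequality for the Ruzsa distance: sets that are both close to \<open>B\<close> are close to each other.
\<close>

lemma ruzsa_triangle:
  fixes A B C :: "'a::ab_group_add set"
  assumes "finite A" "finite B" "finite C"
  shows "real (card (A + C)) * real (card B) \<le> real (card (A + B)) * real (card (uminus ` B + C))"
proof -
  have "real (card (A + C)) * real (card B) \<le> real (card ((A + B) \<times> (uminus ` B + C)))"
  proof (rule card_fibres_le[where h = "\<lambda>(u, v). u + v"])
    fix d assume "d \<in> A + C"
    then obtain a c where ac: "a \<in> A" "c \<in> C" "d = a + c" by (auto simp: set_plus_def)
    show "\<exists>(E :: 'a set) \<iota>. real (card B) \<le> real (card E) \<and> inj_on \<iota> E \<and>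
          \<iota> ` E \<subseteq> {z \<in> (A + B) \<times> (uminus ` B + C). (case z of (u, v) \<Rightarrow> u + v) = d}"
    proof (intro exI conjI)
      show "inj_on (\<lambda>b. (a + b, - b + c)) B" by (auto simp: inj_on_def)
      show "(\<lambda>b. (a + b, - b + c)) ` B \<subseteq> {z \<in> (A + B) \<times> (uminus ` B + C). (case z of (u, v) \<Rightarrow> u + v) = d}"
        using ac by (auto simp del: add_uminus_conv_diff uminus_add_conv_diff intro!: set_plus_intro)
    qed simp
  qed (use assms in \<open>auto intro: finite_set_plus\<close>)
  thus ?thesis by (simp add: card_cartesian_product)
qed

text \<open>
  A maximal set of pairwise disjoint translates of \<open>D\<close> by elements of \<open>E\<close> must meet every further
  translate.
\<close>

lemma ruzsa_covering:
  fixes E D :: "'a::ab_group_add set"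
  assumes "finite E" "finite D" "D \<noteq> {}"
  shows "\<exists>Z\<subseteq>E. real (card Z) * real (card D) \<le> real (card (E + D)) \<and> E \<subseteq> Z + (D + uminus ` D)"
proof -
  \<comment> \<open>the translates of \<open>D\<close> by elements of \<open>Z\<close> are pairwise disjoint\<close>
  define P where "P = (\<lambda>Z. Z \<subseteq> E \<and> inj_on (\<lambda>(z, d). z + d) (Z \<times> D))"
  have "P {}" by (auto simp: P_def)
  have bnd: "\<forall>Z. P Z \<longrightarrow> card Z < Suc (card E)"
    using assms by (auto simp: P_def simp: less_Suc_eq_le intro: card_mono)
  obtain Z where Z: "P Z" and maxi: "\<And>Z'. P Z' \<Longrightarrow> card Z' \<le> card Z"
    using ex_has_greatest_nat[of P "{}" card "Suc (card E)"] \<open>P {}\<close> bnd by blast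
  have fZ: "finite Z" using Z assms by (auto simp: P_def intro: finite_subset)
  have "(\<lambda>(z, d). z + d) ` (Z \<times> D) \<subseteq> E + D" using Z by (auto simp: P_def)
  hence "card (Z \<times> D) \<le> card (E + D)"
    using Z assms unfolding P_def by (intro card_inj_on_le) (auto intro: finite_set_plus)
  moreover have "E \<subseteq> Z + (D + uminus ` D)"
  proof
    fix x assume x: "x \<in> E"
    show "x \<in> Z + (D + uminus ` D)"
    proof (cases "x \<in> Z")
      case True
      obtain d where "d \<in> D" using assms by auto
      hence "x + (d + - d) \<in> Z + (D + uminus ` D)" using True by (intro set_plus_intro) auto
      thus ?thesis by simp
    next
      case False
      hence "\<not> P (insert x Z)" using maxi[of "insert x Z"] fZ by auto
      obtain z d z' d' where zd: "z \<in> insert x Z" "z' \<in> insert x Z" "d \<in> D" "d' \<in> D"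
        "z + d = z' + d'" "z \<noteq> z'"
      proof -
        have "insert x Z \<subseteq> E" using Z x by (auto simp: P_def)
        hence "\<not> inj_on (\<lambda>(z, d). z + d) (insert x Z \<times> D)"
          using \<open>\<not> P (insert x Z)\<close> by (simp add: P_def)
        then obtain q q' where q: "q \<in> insert x Z \<times> D" "q' \<in> insert x Z \<times> D" "q \<noteq> q'"
          "fst q + snd q = fst q' + snd q'" unfolding inj_on_def case_prod_unfold by blast
        show thesis
          by (rule that[of "fst q" "fst q'" "snd q" "snd q'"]) (use q in \<open>auto simp: prod_eq_iff\<close>)
      qed
      have "z \<noteq> x \<or> z' \<noteq> x" using zd by auto
      moreover have "\<not> (z \<noteq> x \<and> z' \<noteq> x)"
      proof
        assume "z \<noteq> x \<and> z' \<noteq> x"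
        hence mem: "(z, d) \<in> Z \<times> D" "(z', d') \<in> Z \<times> D" using zd by auto
        have "inj_on (\<lambda>(z, d). z + d) (Z \<times> D)" using Z by (simp add: P_def)
        from inj_onD[OF this _ mem] zd(5,6) show False by simp
      qed
      ultimately consider "z = x" "z' \<in> Z" | "z' = x" "z \<in> Z" using zd by blast
      thus ?thesis
      proof cases
        case 1
        hence "x = z' + (d' + - d)" using zd by (simp add: algebra_simps)
        moreover have "z' + (d' + - d) \<in> Z + (D + uminus ` D)"
          using 1 zd by (intro set_plus_intro imageI)
        ultimately show ?thesis by simp
      next
        case 2
        hence "x = z + (d + - d')" using zd by (simp add: algebra_simps)
        moreover have "z + (d + - d') \<in> Z + (D + uminus ` D)"
          using 2 zd by (intro set_plus_intro imageI)
        ultimately show ?thesis by simp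
      qed
    qed
  qed
  ultimately show ?thesis using Z unfolding P_def
    by (intro exI[of _ Z]) (auto simp: card_cartesian_product simp flip: of_nat_mult)
qed

section \<open>The Balog-Szemeredi-Gowers theorem\<close>

text \<open>
  A pair \<open>(a, a')\<close> with few common neighbours lies in the neighbourhood of few \<open>b\<close>, so in the
  neighbourhood \<open>X\<close> of a typical \<open>b\<close> only a small proportion of the pairs is bad. A weighted average makes
  \<open>X\<close> large at the same time.
\<close>

lemma dependent_choice_of_neighbourhood:
  fixes A :: "'a set" and B :: "'b set" and M K :: real
  assumes fin: "finite A" "finite B" and M: "real (card A) \<le> M" "real (card B) \<le> M" "0 < M"
    and K: "2 \<le> K" and G: "G \<subseteq> A \<times> B" "M\<^sup>2 / K \<le> real (card G)"
  shows "\<exists>X\<subseteq>A. M / K\<^sup>2 \<le> real (card X) \<and>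
     real (card {(a, a') \<in> X \<times> X. real (card {b \<in> B. (a, b) \<in> G \<and> (a', b) \<in> G}) < M / K ^ 7})
       \<le> (real (card X))\<^sup>2 / 16"
proof -
  define N where "N = (\<lambda>b. {a \<in> A. (a, b) \<in> G})"
  define cod where "cod = (\<lambda>(a, a'). {b \<in> B. (a, b) \<in> G \<and> (a', b) \<in> G})"
  \<comment> \<open>the pairs with few common neighbours\<close>
  define BP where "BP = {q \<in> A \<times> A. real (card (cod q)) < M / K ^ 7}"
  define Bad where "Bad = (\<lambda>b. {q \<in> BP. fst q \<in> N b \<and> snd q \<in> N b})"
  have fBP: "finite BP" using fin by (auto simp: BP_def)
  have "(\<Sum>b\<in>B. real (card (N b))) = real (card (SIGMA b:B. N b))"
    using fin by (subst card_SigmaI) (auto simp: N_def)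
  also have "(SIGMA b:B. N b) = prod.swap ` G" using G by (force simp: N_def image_iff)
  also have "card \<dots> = card G" by (intro card_image) auto
  finally have sumN: "M\<^sup>2 / K \<le> (\<Sum>b\<in>B. real (card (N b)))" using G by simp
  have "(M\<^sup>2 / K)\<^sup>2 \<le> (\<Sum>b\<in>B. real (card (N b)))\<^sup>2"
    using sumN M K by (intro power_mono) auto
  also have "\<dots> \<le> M * (\<Sum>b\<in>B. (real (card (N b)))\<^sup>2)" by (rule sum_square_le) fact
  finally have "M * (M ^ 3 / K\<^sup>2) \<le> M * (\<Sum>b\<in>B. (real (card (N b)))\<^sup>2)"
    by (simp add: power2_eq_square power3_eq_cube field_simps)
  hence sq: "M ^ 3 / K\<^sup>2 \<le> (\<Sum>b\<in>B. (real (card (N b)))\<^sup>2)"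
    using M by (subst (asm) mult_le_cancel_left_pos) auto
  have "(\<Sum>b\<in>B. real (card (Bad b))) = (\<Sum>q\<in>BP. real (card {b \<in> B. fst q \<in> N b \<and> snd q \<in> N b}))"
    unfolding Bad_def by (rule double_count) (use fin fBP in auto)
  also have "\<dots> \<le> (\<Sum>q\<in>BP. M / K ^ 7)"
  proof (rule sum_mono)
    fix q assume "q \<in> BP"
    hence "real (card (cod q)) < M / K ^ 7" "q \<in> A \<times> A" by (auto simp: BP_def)
    moreover have "{b \<in> B. fst q \<in> N b \<and> snd q \<in> N b} \<subseteq> cod q" by (auto simp: cod_def N_def split: prod.splits)
    hence "card {b \<in> B. fst q \<in> N b \<and> snd q \<in> N b} \<le> card (cod q)"
      using fin by (intro card_mono) (auto simp: cod_def split: prod.splits)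
    ultimately show "real (card {b \<in> B. fst q \<in> N b \<and> snd q \<in> N b}) \<le> M / K ^ 7" by linarith
  qed
  also have "\<dots> = real (card BP) * (M / K ^ 7)" by simp
  also have "\<dots> \<le> (M * M) * (M / K ^ 7)"
  proof (intro mult_right_mono)
    have "card BP \<le> card (A \<times> A)" using fin by (intro card_mono) (auto simp: BP_def)
    hence "real (card BP) \<le> real (card A) * real (card A)"
      by (simp add: card_cartesian_product flip: of_nat_mult)
    also have "\<dots> \<le> M * M" using M by (intro mult_mono) auto
    finally show "real (card BP) \<le> M * M" .
  qed (use M K in auto)
  finally have bad: "(\<Sum>b\<in>B. real (card (Bad b))) \<le> M ^ 3 / K ^ 7"
    by (simp add: power3_eq_cube)
  \<comment> \<open>the weight \<open>K\<^sup>5 / 2\<close> balances the two averages\<close>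
  have "M ^ 3 / (2 * K\<^sup>2) = M ^ 3 / K\<^sup>2 - K ^ 5 / 2 * (M ^ 3 / K ^ 7)"
    using K by (simp add: field_simps power_numeral_reduce)
  also have "\<dots> \<le> (\<Sum>b\<in>B. (real (card (N b)))\<^sup>2) - K ^ 5 / 2 * (\<Sum>b\<in>B. real (card (Bad b)))"
    using K by (intro diff_mono sq mult_left_mono bad) auto
  also have "\<dots> = (\<Sum>b\<in>B. (real (card (N b)))\<^sup>2 - K ^ 5 / 2 * real (card (Bad b)))"
    by (simp add: sum_subtractf sum_distrib_left)
  finally obtain b where b: "b \<in> B"
    "M ^ 3 / (2 * K\<^sup>2) / M \<le> (real (card (N b)))\<^sup>2 - K ^ 5 / 2 * real (card (Bad b))"
    using exists_ge_average[of B M "M ^ 3 / (2 * K\<^sup>2)"] fin M K by fastforce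
  define m where "m = real (card (N b))"
  have b': "M\<^sup>2 / (2 * K\<^sup>2) \<le> m\<^sup>2 - K ^ 5 / 2 * real (card (Bad b))"
    using b M K by (simp add: m_def power2_eq_square power3_eq_cube field_simps)
  have "K\<^sup>2 \<ge> 2\<^sup>2" using K by (intro power_mono) auto
  hence "2 * K\<^sup>2 \<le> K\<^sup>2 * K\<^sup>2" by (intro mult_right_mono) auto
  hence "2 * K\<^sup>2 \<le> (K\<^sup>2)\<^sup>2" by (simp add: power2_eq_square)
  hence "(M / K\<^sup>2)\<^sup>2 \<le> M\<^sup>2 / (2 * K\<^sup>2)"
    unfolding power_divide using K by (intro divide_left_mono) auto
  also have "\<dots> \<le> m\<^sup>2 - K ^ 5 / 2 * real (card (Bad b))" by fact
  also have "\<dots> \<le> m\<^sup>2" using K by simp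
  finally have m1: "M / K\<^sup>2 \<le> m" by (rule power2_le_imp_le) (simp add: m_def)
  have "K ^ 5 \<ge> 2 ^ 5" using K by (intro power_mono) auto
  hence "16 * real (card (Bad b)) \<le> K ^ 5 / 2 * real (card (Bad b))" by (intro mult_right_mono) auto
  also have "\<dots> \<le> m\<^sup>2 - M\<^sup>2 / (2 * K\<^sup>2)" using b' by simp
  also have "\<dots> \<le> m\<^sup>2" by simp
  finally have m2: "real (card (Bad b)) \<le> m\<^sup>2 / 16" by simp
  have eq: "{(a, a') \<in> N b \<times> N b. real (card {b \<in> B. (a, b) \<in> G \<and> (a', b) \<in> G}) < M / K ^ 7} = Bad b"
    by (auto simp: Bad_def BP_def cod_def N_def)
  show ?thesis
    by (rule exI[of _ "N b"]) (use m1 m2 eq in \<open>auto simp: m_def N_def\<close>)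
qed


text \<open>
  Sums along the edges of a dense bipartite graph that take few values force large subsets with a small
  sumset. In the set \<open>X\<close> of the preceding lemma, the difference of a pair with many common neighbours is
  in many ways a difference of two edge sums; so these differences form a small set \<open>Q\<close>. After
  removing the few elements of \<open>X\<close> with many bad partners, any two elements have half of \<open>X\<close> as common
  good partners, so every difference lies in many ways in \<open>Q - Q\<close>, and \<open>A'\<close> has a small difference set.
  The other side consists of those \<open>b\<close> that are joined to much of \<open>A'\<close>, and \<open>a + b\<close> is a difference in \<open>A'\<close>
  plus an edge sum in many ways.
\<close>

lemma balog_szemeredi_gowers:
  fixes A B :: "'a::ab_group_add set" and M K :: real
  assumes fin: "finite A" "finite B" and M: "real (card A) \<le> M" "real (card B) \<le> M" "0 < M"
    and K: "2 \<le> K" and G: "G \<subseteq> A \<times> B" "M\<^sup>2 / K \<le> real (card G)"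
    and P: "real (card ((\<lambda>(a, b). a + b) ` G)) \<le> M"
  shows "\<exists>A'\<subseteq>A. \<exists>B'\<subseteq>B. M / K ^ 11 \<le> real (card A') \<and> M / K ^ 11 \<le> real (card B') \<and>
           real (card (A' + B')) \<le> K ^ 28 * M"
proof -
  define Pop where "Pop = (\<lambda>(a, b). a + b) ` G"
  have fG: "finite G" using G fin by (meson finite_SigmaI finite_subset)
  have fPop: "finite Pop" using fG by (simp add: Pop_def)
  define cod where "cod = (\<lambda>a a'. {b \<in> B. (a, b) \<in> G \<and> (a', b) \<in> G})"
  define bad where "bad = (\<lambda>a a'. real (card (cod a a')) < M / K ^ 7)"
  have bad_sym: "bad a a' \<longleftrightarrow> bad a' a" for a a'
    by (simp add: bad_def cod_def conj_commute)
  obtain X where X: "X \<subseteq> A" "M / K\<^sup>2 \<le> real (card X)"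
    "real (card {(a, a') \<in> X \<times> X. bad a a'}) \<le> (real (card X))\<^sup>2 / 16"
    using dependent_choice_of_neighbourhood[OF fin M K G] unfolding bad_def cod_def by blast
  define m where "m = real (card X)"
  have fX: "finite X" using X fin by (auto intro: finite_subset)
  have m: "M / K\<^sup>2 \<le> m" "0 < m"
  proof -
    show "M / K\<^sup>2 \<le> m" using X by (simp add: m_def)
    moreover have "0 < M / K\<^sup>2" using M K by simp
    ultimately show "0 < m" by linarith
  qed
  define A' where "A' = {a \<in> X. real (card {a' \<in> X. bad a a'}) \<le> m / 4}"
  have fA': "finite A'" using fX by (simp add: A'_def)
  have "real (card (X - A')) * (m / 4) \<le> (\<Sum>a\<in>X - A'. real (card {a' \<in> X. bad a a'}))"
    by (rule sum_bounded_below) (auto simp: A'_def)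
  also have "\<dots> \<le> (\<Sum>a\<in>X. real (card {a' \<in> X. bad a a'}))"
    using fX by (intro sum_mono2) auto
  also have "\<dots> = real (card (SIGMA a:X. {a' \<in> X. bad a a'}))"
    using fX by (subst card_SigmaI) auto
  also have "(SIGMA a:X. {a' \<in> X. bad a a'}) = {(a, a') \<in> X \<times> X. bad a a'}" by auto
  also have "real (card \<dots>) \<le> m * m / 16" using X by (simp add: m_def power2_eq_square)
  finally have "real (card (X - A')) * m \<le> (m / 4) * m" by (simp add: mult_ac)
  hence "real (card (X - A')) \<le> m / 4" using m by (subst (asm) mult_le_cancel_right_pos) auto
  moreover have "card (X - A') = card X - card A'" "card A' \<le> card X"
    using fX by (auto simp: card_Diff_subset A'_def intro: card_mono)
  ultimately have cA': "3 * m / 4 \<le> real (card A')" unfolding m_def by linarith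
  have K0: "K > 0" using K by simp
  have "M / K ^ 3 \<le> m / 2"
  proof -
    have "M / K ^ 3 = (M / K\<^sup>2) / K" by (simp add: power3_eq_cube power2_eq_square)
    also have "\<dots> \<le> (M / K\<^sup>2) / 2" using K M by (intro divide_left_mono) auto
    also have "\<dots> \<le> m / 2" using m by simp
    finally show ?thesis .
  qed
  hence mK3: "M / K ^ 3 \<le> m / 2" .
  define Q where "Q = {d. M / K ^ 7 \<le> real (card {z \<in> Pop \<times> Pop. fst z - snd z = d})}"
  have goodQ: "a - a' \<in> Q" if "\<not> bad a a'" for a a'
  proof -
    have "card (cod a a') \<le> card {z \<in> Pop \<times> Pop. fst z - snd z = a - a'}"
    proof (rule card_inj_on_le)
      show "inj_on (\<lambda>b. (a + b, a' + b)) (cod a a')" by (auto simp: inj_on_def)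
      show "(\<lambda>b. (a + b, a' + b)) ` cod a a' \<subseteq> {z \<in> Pop \<times> Pop. fst z - snd z = a - a'}"
        by (force simp: cod_def Pop_def image_iff)
    qed (use fPop in auto)
    thus ?thesis using that by (simp add: Q_def bad_def)
  qed
  have cPop: "real (card Pop) \<le> M" using P by (simp add: Pop_def)
  have fQ: "finite Q"
  proof (rule finite_subset)
    show "Q \<subseteq> (\<lambda>z. fst z - snd z) ` (Pop \<times> Pop)"
    proof
      fix d assume "d \<in> Q"
      moreover have "0 < M / K ^ 7" using M K by simp
      ultimately have "0 < real (card {z \<in> Pop \<times> Pop. fst z - snd z = d})" by (auto simp: Q_def)
      hence "{z \<in> Pop \<times> Pop. fst z - snd z = d} \<noteq> {}" by (metis card.empty of_nat_0 less_irrefl)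
      thus "d \<in> (\<lambda>z. fst z - snd z) ` (Pop \<times> Pop)" by blast
    qed
  qed (use fPop in auto)
  have "real (card Q) * (M / K ^ 7) \<le> real (card (Pop \<times> Pop))"
  proof (rule card_fibres_le[where h = "\<lambda>z. fst z - snd z"])
    fix d assume "d \<in> Q"
    thus "\<exists>(C :: ('a \<times> 'a) set) \<iota>. M / K ^ 7 \<le> real (card C) \<and> inj_on \<iota> C \<and>
            \<iota> ` C \<subseteq> {z \<in> Pop \<times> Pop. fst z - snd z = d}"
      by (intro exI[of _ "{z \<in> Pop \<times> Pop. fst z - snd z = d}"] exI[of _ id]) (auto simp: Q_def)
  qed (use fPop in auto)
  also have "\<dots> \<le> M * M" using cPop M by (auto simp: card_cartesian_product intro!: mult_mono)
  finally have cQ: "real (card Q) \<le> K ^ 7 * M" using M K by (simp add: field_simps)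
  define Df where "Df = (\<lambda>(a, a'). a - a') ` (A' \<times> A')"
  have fDf: "finite Df" using fA' by (simp add: Df_def)
  have "real (card Df) * (m / 2) \<le> real (card (Q \<times> Q))"
  proof (rule card_fibres_le[where h = "\<lambda>z. fst z - snd z"])
    fix d assume "d \<in> Df"
    then obtain a a' where a: "a \<in> A'" "a' \<in> A'" "d = a - a'" by (auto simp: Df_def)
    define C where "C = X - ({a'' \<in> X. bad a a''} \<union> {a'' \<in> X. bad a' a''})"
    have "real (card ({a'' \<in> X. bad a a''} \<union> {a'' \<in> X. bad a' a''})) \<le> m / 4 + m / 4"
      using card_Un_le[of "{a'' \<in> X. bad a a''}" "{a'' \<in> X. bad a' a''}"] a
      by (simp add: A'_def)
    moreover have "real (card C) = m - real (card ({a'' \<in> X. bad a a''} \<union> {a'' \<in> X. bad a' a''}))"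
      unfolding C_def m_def using fX by (subst card_Diff_subset) (auto intro!: of_nat_diff card_mono)
    ultimately have "m / 2 \<le> real (card C)" by simp
    moreover have "inj_on (\<lambda>x. (a - x, a' - x)) C" by (auto simp: inj_on_def)
    moreover have "(\<lambda>x. (a - x, a' - x)) ` C \<subseteq> {z \<in> Q \<times> Q. fst z - snd z = d}"
      using goodQ a by (auto simp: C_def)
    ultimately show "\<exists>(C :: 'a set) \<iota>. m / 2 \<le> real (card C) \<and> inj_on \<iota> C \<and>
            \<iota> ` C \<subseteq> {z \<in> Q \<times> Q. fst z - snd z = d}" by blast
  qed (use fQ in auto)
  also have "\<dots> \<le> (K ^ 7 * M) * (K ^ 7 * M)"
    using cQ M K by (auto simp: card_cartesian_product intro!: mult_mono)
  finally have "real (card Df) * (m / 2) \<le> K ^ 14 * M\<^sup>2"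
    by (simp add: power2_eq_square mult_ac flip: power_add)
  moreover have "real (card Df) * (M / K ^ 3) \<le> real (card Df) * (m / 2)"
    using mK3 by (intro mult_left_mono) auto
  moreover have "K ^ 14 * M\<^sup>2 = (K ^ 17 * M) * (M / K ^ 3)"
    using K0 by (simp add: field_simps power2_eq_square flip: power_add)
  ultimately have "real (card Df) * (M / K ^ 3) \<le> (K ^ 17 * M) * (M / K ^ 3)" by linarith
  hence cDf: "real (card Df) \<le> K ^ 17 * M"
    using M K0 by (subst (asm) mult_le_cancel_right_pos) auto
  have deg: "M / K ^ 7 \<le> real (card {b \<in> B. (a, b) \<in> G})" if a: "a \<in> A'" for a
  proof -
    have "{a' \<in> X. bad a a'} \<noteq> X"
      using a m by (auto simp: A'_def m_def)
    then obtain a' where "\<not> bad a a'" by blast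
    moreover have "card (cod a a') \<le> card {b \<in> B. (a, b) \<in> G}"
      using fin by (intro card_mono) (auto simp: cod_def)
    ultimately show ?thesis by (simp add: bad_def)
  qed
  define B' where "B' = {b \<in> B. M / K ^ 11 \<le> real (card {a \<in> A'. (a, b) \<in> G})}"
  have mA': "M / K ^ 3 \<le> real (card A')" using cA' mK3 m by linarith
  have "A' \<subseteq> A" using X by (auto simp: A'_def)
  hence A'M: "real (card A') \<le> M"
    using M card_mono[OF fin(1), of A'] by linarith
  have "(M / K ^ 3) * (M / K ^ 7) \<le> real (card A') * (M / K ^ 7)"
    using mA' M K0 by (intro mult_right_mono) auto
  also have "\<dots> \<le> (\<Sum>a\<in>A'. real (card {b \<in> B. (a, b) \<in> G}))"
    using deg by (rule sum_bounded_below)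
  also have "\<dots> = (\<Sum>b\<in>B. real (card {a \<in> A'. (a, b) \<in> G}))"
    by (rule double_count[OF fA' fin(2)])
  also have "\<dots> \<le> (\<Sum>b\<in>B. (if b \<in> B' then M else 0) + M / K ^ 11)"
  proof (rule sum_mono)
    fix b assume "b \<in> B"
    have "real (card {a \<in> A'. (a, b) \<in> G}) \<le> M"
      using A'M card_mono[OF fA', of "{a \<in> A'. (a, b) \<in> G}"] by auto
    thus "real (card {a \<in> A'. (a, b) \<in> G}) \<le> (if b \<in> B' then M else 0) + M / K ^ 11"
      using \<open>b \<in> B\<close> M K0 by (auto simp: B'_def intro: add_increasing2)
  qed
  also have "\<dots> = real (card B') * M + real (card B) * (M / K ^ 11)"
    using fin by (simp add: sum.distrib B'_def flip: sum.inter_filter)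
  also have "\<dots> \<le> real (card B') * M + M * (M / K ^ 11)"
    using M K0 by (intro add_left_mono mult_right_mono) auto
  finally have "M * (M / K ^ 10) \<le> M * (real (card B') + M / K ^ 11)"
    by (simp add: algebra_simps flip: power_add)
  hence "M / K ^ 10 \<le> real (card B') + M / K ^ 11" using M by (subst (asm) mult_le_cancel_left_pos) auto
  moreover have "2 * (M / K ^ 11) \<le> M / K ^ 10"
    using M K by (simp add: field_simps power_numeral_reduce)
  ultimately have cB': "M / K ^ 11 \<le> real (card B')" by linarith
  have "real (card (A' + B')) * (M / K ^ 11) \<le> real (card (Df \<times> Pop))"
  proof (rule card_fibres_le[where h = "\<lambda>z. fst z + snd z"])
    fix d assume "d \<in> A' + B'"
    then obtain a b where ab: "a \<in> A'" "b \<in> B'" "d = a + b" by (auto simp: set_plus_def)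
    show "\<exists>(C :: 'a set) \<iota>. M / K ^ 11 \<le> real (card C) \<and> inj_on \<iota> C \<and>
            \<iota> ` C \<subseteq> {z \<in> Df \<times> Pop. fst z + snd z = d}"
    proof (intro exI conjI)
      show "M / K ^ 11 \<le> real (card {x \<in> A'. (x, b) \<in> G})" using ab by (simp add: B'_def)
      show "inj_on (\<lambda>x. (a - x, x + b)) {x \<in> A'. (x, b) \<in> G}" by (auto simp: inj_on_def)
      show "(\<lambda>x. (a - x, x + b)) ` {x \<in> A'. (x, b) \<in> G} \<subseteq> {z \<in> Df \<times> Pop. fst z + snd z = d}"
        using ab by (force simp: Df_def Pop_def)
    qed
  qed (use fDf fPop in auto)
  also have "\<dots> \<le> (K ^ 17 * M) * M"
    using cDf cPop M K0 by (auto simp: card_cartesian_product intro!: mult_mono)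
  also have "\<dots> = (K ^ 28 * M) * (M / K ^ 11)"
    using K0 by (simp add: field_simps flip: power_add)
  finally have "real (card (A' + B')) \<le> K ^ 28 * M"
    using M K0 by (subst (asm) mult_le_cancel_right_pos) auto
  moreover have "M / K ^ 11 \<le> M / K ^ 3"
    using M K by (intro divide_left_mono power_increasing) auto
  hence "M / K ^ 11 \<le> real (card A')" using mA' by linarith
  moreover have "A' \<subseteq> A" "B' \<subseteq> B" using X by (auto simp: A'_def B'_def)
  ultimately show ?thesis using cB' by blast
qed

lemma card_set_plus_ge:
  fixes A B :: "'a::ab_group_add set"
  assumes "finite A" "finite B" "B \<noteq> {}"
  shows "card A \<le> card (A + B)"
proof -
  obtain b where b: "b \<in> B" using assms by blast
  show ?thesis
    by (rule card_inj_on_le[of "\<lambda>a. a + b"]) (use b assms in \<open>auto simp: finite_set_plus\<close>)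
qed

lemma uminus_set_plus: "uminus ` (A + B) = uminus ` A + uminus ` (B :: 'a::ab_group_add set)"
proof (intro equalityI subsetI)
  fix x assume "x \<in> uminus ` (A + B)"
  then obtain a b where ab: "a \<in> A" "b \<in> B" "x = - (a + b)" by (auto simp: set_plus_def)
  have "- a + - b \<in> uminus ` A + uminus ` B" using ab by (intro set_plus_intro imageI)
  thus "x \<in> uminus ` A + uminus ` B" using ab by simp
next
  fix x assume "x \<in> uminus ` A + uminus ` B"
  then obtain a b where ab: "a \<in> A" "b \<in> B" "x = - a + - b" by (auto simp: set_plus_def)
  hence "x = - (a + b)" by simp
  thus "x \<in> uminus ` (A + B)" using ab by blast
qed

section \<open>Popular differences of a set of small doubling\<close>

locale small_doubling =
  fixes X :: "'a::ab_group_add set" and K :: real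
  assumes finX: "finite X" and X_nonempty: "X \<noteq> {}" and K2: "2 \<le> K"
    and small: "real (card (X + uminus ` X)) \<le> K * real (card X)"
begin

text \<open>
  On average over \<open>X - X\<close>, a difference has at least \<open>|X| / K\<close> representations; \<open>D\<close> consists of those
  with at least half as many. By the following lemmas, all sums of boundedly many elements
  of \<open>D\<close> remain in a set of size comparable to \<open>|X|\<close>, so that \<open>H = D + D\<close> is
  an approximate group. This replaces Pluennecke's inequality.
\<close>

definition D :: "'a set" where
  "D = {d. real (card X) / (2 * K) \<le> real (card {c \<in> X. c + d \<in> X})}"

definition H :: "'a set" where "H = D + D"

lemma K0: "0 < K" using K2 by simp

lemma cardX: "0 < real (card X)" using finX X_nonempty by (simp add: card_gt_0_iff)

lemma zero_in_D: "0 \<in> D"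
  using cardX K2 by (simp add: D_def field_simps)

lemma uminus_D: "uminus ` D = D"
proof -
  have "card {c \<in> X. c + d \<in> X} = card {c \<in> X. c - d \<in> X}" for d
    by (rule bij_betw_same_card[of "\<lambda>c. c + d"], rule bij_betwI[where g = "\<lambda>c. c - d"]) auto
  hence "- d \<in> D" if "d \<in> D" for d using that by (simp add: D_def)
  thus ?thesis by (metis (no_types, lifting) image_subset_iff minus_minus subsetI subset_antisym image_eqI)
qed

lemma D_subset: "D \<subseteq> X + uminus ` X"
proof
  fix d assume "d \<in> D"
  moreover have "0 < real (card X) / (2 * K)" using cardX K0 by simp
  ultimately have "0 < real (card {c \<in> X. c + d \<in> X})" unfolding D_def by (auto simp del: of_nat_0_less_iff)
  hence "{c \<in> X. c + d \<in> X} \<noteq> {}" by (metis card.empty of_nat_0 less_irrefl)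
  then obtain c where c: "c \<in> X" "c + d \<in> X" by blast
  hence "(c + d) + - c \<in> X + uminus ` X" by (intro set_plus_intro imageI)
  thus "d \<in> X + uminus ` X" by simp
qed

lemma finD: "finite D"
  by (rule finite_subset[OF D_subset]) (use finX in \<open>auto intro: finite_set_plus\<close>)

lemma card_D: "real (card X) / 2 \<le> real (card D)"
proof -
  let ?m = "real (card X)"
  have fin: "finite (X + uminus ` X)" using finX by (auto intro: finite_set_plus)
  have "?m * ?m = (\<Sum>c\<in>X. ?m)" by simp
  also have "\<dots> \<le> (\<Sum>c\<in>X. real (card {d \<in> X + uminus ` X. c + d \<in> X}))"
  proof (intro sum_mono of_nat_mono)
    fix c assume c: "c \<in> X"
    show "card X \<le> card {d \<in> X + uminus ` X. c + d \<in> X}"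
    proof (rule card_inj_on_le[of "\<lambda>x. x + - c"])
      show "(\<lambda>x. x + - c) ` X \<subseteq> {d \<in> X + uminus ` X. c + d \<in> X}"
      proof clarify
        fix x assume "x \<in> X"
        moreover have "x + - c \<in> X + uminus ` X" using c \<open>x \<in> X\<close> by (intro set_plus_intro imageI)
        ultimately show "x + - c \<in> X + uminus ` X \<and> c + (x + - c) \<in> X" by simp
      qed
    qed (use fin in auto)
  qed
  also have "\<dots> = (\<Sum>d\<in>X + uminus ` X. real (card {c \<in> X. c + d \<in> X}))"
    using fin finX by (intro double_count)
  also have "\<dots> \<le> (\<Sum>d\<in>X + uminus ` X. (if d \<in> D then ?m else 0) + ?m / (2 * K))"
  proof (rule sum_mono)
    fix d
    have "card {c \<in> X. c + d \<in> X} \<le> card X" using finX by (intro card_mono) auto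
    thus "real (card {c \<in> X. c + d \<in> X}) \<le> (if d \<in> D then ?m else 0) + ?m / (2 * K)"
      using K0 by (auto simp: D_def intro: add_increasing2)
  qed
  also have "\<dots> = real (card D) * ?m + real (card (X + uminus ` X)) * (?m / (2 * K))"
    using fin D_subset by (simp add: sum.distrib Int_absorb1 flip: sum.inter_restrict)
  also have "\<dots> \<le> real (card D) * ?m + (K * ?m) * (?m / (2 * K))"
    using K0 by (intro add_left_mono mult_right_mono small) auto
  also have "\<dots> = (real (card D) + ?m / 2) * ?m" using K0 by (simp add: field_simps)
  finally have "?m \<le> real (card D) + ?m / 2"
    using cardX by (subst (asm) mult_le_cancel_right_pos) auto
  thus ?thesis by simp
qed

text \<open>
  A popular difference \<open>d\<close> is \<open>(c + d) - c\<close> in many ways, so \<open>x + d\<close> is the difference of \<open>x + (c + d)\<close>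
  and \<open>c\<close>. Thus, up to a constant factor, \<open>D\<close> may be replaced by \<open>X\<close> in any sumset.
\<close>

lemma card_plus_D:
  assumes "finite E"
  shows "real (card (E + D)) \<le> 2 * K * real (card (E + X))"
proof -
  let ?m = "real (card X)"
  have "real (card (E + D)) * (?m / (2 * K)) \<le> real (card (X \<times> (E + X)))"
  proof (rule card_fibres_le[where h = "\<lambda>z. snd z - fst z"])
    fix z assume "z \<in> E + D"
    then obtain x d where xd: "x \<in> E" "d \<in> D" "z = x + d" by (auto simp: set_plus_def)
    show "\<exists>(C :: 'a set) \<iota>. ?m / (2 * K) \<le> real (card C) \<and> inj_on \<iota> C \<and>
            \<iota> ` C \<subseteq> {z' \<in> X \<times> (E + X). snd z' - fst z' = z}"
    proof (intro exI conjI)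
      show "?m / (2 * K) \<le> real (card {c \<in> X. c + d \<in> X})" using xd by (simp add: D_def)
      show "inj_on (\<lambda>c. (c, x + (c + d))) {c \<in> X. c + d \<in> X}" by (auto simp: inj_on_def)
      show "(\<lambda>c. (c, x + (c + d))) ` {c \<in> X. c + d \<in> X} \<subseteq> {z' \<in> X \<times> (E + X). snd z' - fst z' = z}"
        using xd by auto
    qed
  qed (use assms finX in \<open>auto intro: finite_set_plus\<close>)
  hence "?m * real (card (E + D)) \<le> ?m * (2 * K * real (card (E + X)))"
    using K0 by (simp add: card_cartesian_product field_simps)
  thus ?thesis using cardX by (subst (asm) mult_le_cancel_left_pos) auto
qed

text \<open>
  Write \<open>d = (c + d) - c\<close> and regroup \<open>x + d - y\<close> as \<open>(x - c) + ((c + d) - y)\<close>: the second summand is a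
  difference in \<open>X\<close>, and the set \<open>D\<close> has disappeared from the first. Iteration removes any number of copies of \<open>D\<close>.
\<close>

lemma card_plus_D_minus_X:
  assumes "finite E"
  shows "real (card (E + D + uminus ` X)) \<le> K ^ 3 * real (card (E + uminus ` X))"
proof -
  let ?m = "real (card X)"
  have "real (card (E + D + uminus ` X)) * (?m / (2 * K)) \<le> real (card ((E + uminus ` X) \<times> (X + uminus ` X)))"
  proof (rule card_fibres_le[where h = "\<lambda>z. fst z + snd z"])
    fix z assume "z \<in> E + D + uminus ` X"
    then obtain x d y where xd: "x \<in> E" "d \<in> D" "y \<in> X" "z = x + d + - y"
      by (fastforce simp: set_plus_def)
    show "\<exists>(C :: 'a set) \<iota>. ?m / (2 * K) \<le> real (card C) \<and> inj_on \<iota> C \<and>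
            \<iota> ` C \<subseteq> {z' \<in> (E + uminus ` X) \<times> (X + uminus ` X). fst z' + snd z' = z}"
    proof (intro exI conjI)
      show "?m / (2 * K) \<le> real (card {c \<in> X. c + d \<in> X})" using xd by (simp add: D_def)
      show "inj_on (\<lambda>c. (x + - c, c + d + - y)) {c \<in> X. c + d \<in> X}" by (auto simp: inj_on_def)
      show "(\<lambda>c. (x + - c, c + d + - y)) ` {c \<in> X. c + d \<in> X}
              \<subseteq> {z' \<in> (E + uminus ` X) \<times> (X + uminus ` X). fst z' + snd z' = z}"
      proof clarify
        fix c assume c: "c \<in> X" "c + d \<in> X"
        have "x + - c \<in> E + uminus ` X" "c + d + - y \<in> X + uminus ` X"
          using c xd by (auto intro!: set_plus_intro imageI simp del: add_uminus_conv_diff)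
        thus "(x + - c, c + d + - y) \<in> (E + uminus ` X) \<times> (X + uminus ` X) \<and>
                fst (x + - c, c + d + - y) + snd (x + - c, c + d + - y) = z"
          using xd by simp
      qed
    qed
  qed (use assms finX in \<open>auto intro: finite_set_plus\<close>)
  also have "\<dots> \<le> real (card (E + uminus ` X)) * (K * ?m)"
    using small by (simp add: card_cartesian_product mult_left_mono)
  finally have "?m * real (card (E + D + uminus ` X)) \<le> ?m * (2 * K\<^sup>2 * real (card (E + uminus ` X)))"
    using K0 by (simp add: field_simps power2_eq_square)
  hence "real (card (E + D + uminus ` X)) \<le> 2 * K\<^sup>2 * real (card (E + uminus ` X))"
    using cardX by (subst (asm) mult_le_cancel_left_pos) auto
  also have "\<dots> \<le> K ^ 3 * real (card (E + uminus ` X))"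
    using K2 by (intro mult_right_mono) (auto simp: power3_eq_cube power2_eq_square)
  finally show ?thesis .
qed

lemma card_multiple_D:
  "real (card (((+) D ^^ n) {0})) \<le> K ^ (3 * n + 1) * real (card X) \<and> finite (((+) D ^^ n) {0})"
proof -
  let ?N = "\<lambda>n. ((+) D ^^ n) {0}"
  have fin: "finite (?N n)" for n
    by (induction n) (auto intro: finite_set_plus finD)
  have main: "real (card (X + ?N n + uminus ` X)) \<le> K ^ (3 * n + 1) * real (card X)" for n
  proof (induction n)
    case 0
    show ?case using small by simp
  next
    case (Suc n)
    have "X + ?N (Suc n) + uminus ` X = (X + ?N n) + D + uminus ` X"
      by (simp add: add_ac)
    hence "real (card (X + ?N (Suc n) + uminus ` X)) = real (card ((X + ?N n) + D + uminus ` X))" by simp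
    also have "\<dots> \<le> K ^ 3 * real (card (X + ?N n + uminus ` X))"
      using fin finX by (intro card_plus_D_minus_X) (auto intro: finite_set_plus)
    also have "\<dots> \<le> K ^ 3 * (K ^ (3 * n + 1) * real (card X))"
      using Suc K0 by (intro mult_left_mono) auto
    finally show ?case by (simp add: power_add mult_ac eval_nat_numeral)
  qed
  have "card (?N n) \<le> card (?N n + (X + uminus ` X))"
    using X_nonempty fin finX by (intro card_set_plus_ge) (auto simp: set_plus_def intro: finite_set_plus)
  moreover have "?N n + (X + uminus ` X) = X + ?N n + uminus ` X" by (simp add: add_ac)
  ultimately show ?thesis using main[of n] fin by auto
qed

lemma uminus_H: "uminus ` H = H" by (simp add: H_def uminus_set_plus uminus_D)

lemma D_subset_H: "D \<subseteq> H" using set_zero_plus2[OF zero_in_D] by (simp add: H_def)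

lemma finH: "finite H" by (simp add: H_def finD finite_set_plus)

lemma card_H: "real (card H) \<le> K ^ 7 * real (card X)"
  using card_multiple_D[of 2] by (simp add: H_def numeral_2_eq_2)

lemma card_H_ge: "real (card X) / 2 \<le> real (card H)"
  using card_D card_mono[OF finH D_subset_H] by linarith

lemma covering:
  assumes "finite E" "real (card (E + D)) \<le> K ^ n * real (card X)"
  shows "\<exists>Z. finite Z \<and> real (card Z) \<le> K ^ (n + 1) \<and> E \<subseteq> Z + H"
proof -
  obtain Z where Z: "Z \<subseteq> E" "real (card Z) * real (card D) \<le> real (card (E + D))" "E \<subseteq> Z + (D + uminus ` D)"
    using ruzsa_covering[of E D] assms finD zero_in_D by blast
  have "real (card Z) * (real (card X) / 2) \<le> real (card Z) * real (card D)"
    by (intro mult_left_mono card_D) auto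
  also have "\<dots> \<le> K ^ n * real (card X)" using Z assms by linarith
  finally have "real (card X) * real (card Z) \<le> real (card X) * (2 * K ^ n)" by (simp add: field_simps)
  hence "real (card Z) \<le> 2 * K ^ n" using cardX by (subst (asm) mult_le_cancel_left_pos) auto
  also have "\<dots> \<le> K ^ (n + 1)" using K2 by simp
  finally show ?thesis using Z assms by (auto simp: H_def uminus_D intro: finite_subset)
qed

lemma H_plus_H: "\<exists>W. finite W \<and> real (card W) \<le> K ^ 17 \<and> H + H \<subseteq> W + H"
proof -
  have "H + H + D = ((+) D ^^ 5) {0}" by (simp add: H_def numeral_eq_Suc add_ac)
  hence "real (card (H + H + D)) \<le> K ^ 16 * real (card X)"
    using card_multiple_D[of 5] by simp
  thus ?thesis using covering[of "H + H" 16] finH by (simp add: finite_set_plus)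
qed

end

section \<open>Prime fields inside a commutative ring\<close>

text \<open>
  The field is a subset \<open>F\<close> of a ring type and its unit \<open>e\<close> need not be the unit of the ring, so that fields
  of different characteristics fit into one type. The last condition says that \<open>e\<close> generates \<open>F\<close> additively.
\<close>

locale prime_field_in_ring =
  fixes F :: "'a::comm_ring set" and e :: 'a
  assumes finF: "finite F" and e_in: "e \<in> F" and e_nonzero: "e \<noteq> 0"
    and add_in: "x \<in> F \<Longrightarrow> y \<in> F \<Longrightarrow> x + y \<in> F"
    and uminus_in: "x \<in> F \<Longrightarrow> - x \<in> F"
    and mult_in: "x \<in> F \<Longrightarrow> y \<in> F \<Longrightarrow> x * y \<in> F"
    and e_mult: "x \<in> F \<Longrightarrow> e * x = x"
    and inverse_ex: "x \<in> F \<Longrightarrow> x \<noteq> 0 \<Longrightarrow> \<exists>y\<in>F. x * y = e"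
    and generated: "0 \<in> G \<Longrightarrow> (\<And>x. x \<in> G \<Longrightarrow> x + e \<in> G) \<Longrightarrow> F \<subseteq> G"
begin

definition recip :: "'a \<Rightarrow> 'a" where "recip x = (SOME y. y \<in> F \<and> x * y = e)"

lemma recip: "x \<in> F \<Longrightarrow> x \<noteq> 0 \<Longrightarrow> recip x \<in> F" "x \<in> F \<Longrightarrow> x \<noteq> 0 \<Longrightarrow> x * recip x = e"
  using someI_ex[of "\<lambda>y. y \<in> F \<and> x * y = e"] inverse_ex[of x] by (auto simp: recip_def)

lemma diff_in: "x \<in> F \<Longrightarrow> y \<in> F \<Longrightarrow> x - y \<in> F"
  using add_in[OF _ uminus_in, of x y] by simp

lemma zero_in: "0 \<in> F" using diff_in[OF e_in e_in] by simp

lemma mult_e: "x \<in> F \<Longrightarrow> x * e = x" using e_mult[of x] by (simp add: mult.commute[of x])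

lemma recip_nonzero: "x \<in> F \<Longrightarrow> x \<noteq> 0 \<Longrightarrow> recip x \<noteq> 0"
  using recip(2)[of x] e_nonzero by auto

lemma recip_mult_cancel: "r \<in> F \<Longrightarrow> r \<noteq> 0 \<Longrightarrow> x \<in> F \<Longrightarrow> recip r * (r * x) = x"
  using recip(2)[of r] e_mult[of x] by (metis mult.assoc mult.commute)

lemma mult_left_cancel: "r \<in> F \<Longrightarrow> r \<noteq> 0 \<Longrightarrow> x \<in> F \<Longrightarrow> y \<in> F \<Longrightarrow> r * x = r * y \<longleftrightarrow> x = y"
  using recip_mult_cancel by metis

lemma set_plus_in: "A \<subseteq> F \<Longrightarrow> B \<subseteq> F \<Longrightarrow> A + B \<subseteq> F"
  by (auto elim!: set_plus_elim intro!: add_in)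

lemma dilate_in: "r \<in> F \<Longrightarrow> A \<subseteq> F \<Longrightarrow> (*) r ` A \<subseteq> F"
  by (auto simp: mult_in)

lemma card_dilate: "r \<in> F \<Longrightarrow> r \<noteq> 0 \<Longrightarrow> A \<subseteq> F \<Longrightarrow> card ((*) r ` A) = card A"
  by (intro card_image inj_onI) (auto simp: mult_left_cancel subset_iff)

lemma dilate_recip: "r \<in> F \<Longrightarrow> r \<noteq> 0 \<Longrightarrow> A \<subseteq> F \<Longrightarrow> (*) r ` (*) (recip r) ` A = A"
proof -
  assume r: "r \<in> F" "r \<noteq> 0" "A \<subseteq> F"
  have "r * (recip r * x) = x" if "x \<in> A" for x
    using recip_mult_cancel[OF r(1,2), of x] that r by (simp add: mult.left_commute subset_iff)
  thus ?thesis by (force simp: image_iff)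
qed

end

lemma dilate_set_plus: "(*) (r :: 'a::comm_ring) ` (A + B) = (*) r ` A + (*) r ` B"
  using set_times_plus_distrib2[of r A B] by (simp add: elt_set_times_def image_def Bex_def)

section \<open>Dilations that preserve an approximate group\<close>

locale small_doubling_in_field = prime_field_in_ring F e + small_doubling X K
  for F :: "'a::comm_ring set" and e and X :: "'a set" and K +
  assumes X_in: "X \<subseteq> F"
begin

lemma D_in: "D \<subseteq> F"
proof -
  have "uminus ` X \<subseteq> F" using X_in uminus_in by blast
  with D_subset set_plus_in[OF X_in] show ?thesis by blast
qed

lemma H_in: "H \<subseteq> F" unfolding H_def using D_in set_plus_in by blast

text \<open>
  Dilation by \<open>r\<close> maps \<open>H\<close> into few translates of \<open>H\<close>. In this form closure under sums and products is
  immediate; the index records the loss.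
\<close>

definition good :: "nat \<Rightarrow> 'a \<Rightarrow> bool" where
  "good k r \<longleftrightarrow> (\<exists>Z. finite Z \<and> real (card Z) \<le> K ^ k \<and> (*) r ` H \<subseteq> Z + H)"

lemma good_mono:
  assumes "good k r" "k \<le> l"
  shows "good l r"
proof -
  have "K ^ k \<le> K ^ l" using assms K2 by (intro power_increasing) auto
  thus ?thesis using assms unfolding good_def by (blast intro: order_trans)
qed

lemma card_set_plus_power:
  assumes "finite (Y :: 'a set)" "finite Z" "real (card Y) \<le> K ^ j" "real (card Z) \<le> K ^ k"
  shows "finite (Y + Z)" "real (card (Y + Z)) \<le> K ^ (j + k)"
proof -
  show "finite (Y + Z)" using assms by (simp add: finite_set_plus)
  have "real (card (Y + Z)) \<le> real (card Y) * real (card Z)"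
    using card_set_plus_le[of Y Z] assms by (simp flip: of_nat_mult)
  also have "\<dots> \<le> K ^ j * K ^ k" using assms K0 by (intro mult_mono) auto
  finally show "real (card (Y + Z)) \<le> K ^ (j + k)" by (simp add: power_add)
qed

lemma good_add:
  assumes "good j r" "good k s"
  shows "good (j + k + 17) (r + s)"
proof -
  obtain Y Z W where Y: "finite Y" "real (card Y) \<le> K ^ j" "(*) r ` H \<subseteq> Y + H"
    and Z: "finite Z" "real (card Z) \<le> K ^ k" "(*) s ` H \<subseteq> Z + H"
    and W: "finite W" "real (card W) \<le> K ^ 17" "H + H \<subseteq> W + H"
    using assms H_plus_H unfolding good_def by blast
  have "(*) (r + s) ` H \<subseteq> (*) r ` H + (*) s ` H"
    by (auto simp: distrib_right intro: set_plus_intro[OF imageI imageI])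
  also have "\<dots> \<subseteq> (Y + H) + (Z + H)" by (rule set_plus_mono2[OF Y(3) Z(3)])
  also have "\<dots> = Y + Z + (H + H)" by (simp add: add_ac)
  also have "\<dots> \<subseteq> Y + Z + (W + H)" by (rule set_plus_mono2[OF order_refl W(3)])
  finally have "(*) (r + s) ` H \<subseteq> Y + Z + W + H" by (simp add: add_ac)
  thus ?thesis
    using card_set_plus_power[OF card_set_plus_power(1)[OF Y(1) Z(1) Y(2) Z(2)] W(1)
          card_set_plus_power(2)[OF Y(1) Z(1) Y(2) Z(2)] W(2)]
    unfolding good_def by blast
qed

lemma good_uminus: "good k r \<Longrightarrow> good k (- r)"
proof -
  have "(*) (- r) ` H = (*) r ` uminus ` H" by (simp add: image_image)
  thus "good k r \<Longrightarrow> good k (- r)" by (simp add: uminus_H good_def)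
qed

lemma good_diff: "good j r \<Longrightarrow> good k s \<Longrightarrow> good (j + k + 17) (r - s)"
  using good_add[OF _ good_uminus, of j r k s] by simp

lemma good_mult:
  assumes "good j r" "good k s"
  shows "good (j + k) (r * s)"
proof -
  obtain Y Z where Y: "finite Y" "real (card Y) \<le> K ^ j" "(*) r ` H \<subseteq> Y + H"
    and Z: "finite Z" "real (card Z) \<le> K ^ k" "(*) s ` H \<subseteq> Z + H"
    using assms unfolding good_def by blast
  have "(*) (r * s) ` H = (*) r ` (*) s ` H" by (simp add: image_image mult.assoc)
  also have "\<dots> \<subseteq> (*) r ` (Z + H)" using Z by (intro image_mono)
  also have "\<dots> = (*) r ` Z + (*) r ` H" by (rule dilate_set_plus)
  also have "\<dots> \<subseteq> (*) r ` Z + (Y + H)" by (rule set_plus_mono2[OF order_refl Y(3)])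
  finally have "(*) (r * s) ` H \<subseteq> (Y + (*) r ` Z) + H" by (simp add: add_ac)
  moreover have "real (card ((*) r ` Z)) \<le> K ^ k"
    using Z card_image_le[of Z "(*) r"] by linarith
  ultimately show ?thesis
    using card_set_plus_power[OF Y(1) _ Y(2), of "(*) r ` Z" k] Z unfolding good_def by blast
qed

lemma good_e: "good 0 e"
proof -
  have "(*) e ` H = H" using H_in e_mult by (force simp: image_iff subset_iff)
  thus ?thesis unfolding good_def by (intro exI[of _ "{0}"]) auto
qed

text \<open>
  Goodness of \<open>r\<close> bounds \<open>H + r H\<close>, a dilate of \<open>r\<^sup>-\<^sup>1 H + H\<close>; covering turns this bound back into
  goodness of \<open>r\<^sup>-\<^sup>1\<close>.
\<close>

lemma good_recip:
  assumes "good k r" "r \<in> F" "r \<noteq> 0"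
  shows "good (k + 25) (recip r)"
proof -
  obtain Z W where Z: "finite Z" "real (card Z) \<le> K ^ k" "(*) r ` H \<subseteq> Z + H"
    and W: "finite W" "real (card W) \<le> K ^ 17" "H + H \<subseteq> W + H"
    using assms H_plus_H unfolding good_def by blast
  have iH: "(*) (recip r) ` H \<subseteq> F" using assms recip H_in by (intro dilate_in) auto
  have "(*) (recip r) ` H + D \<subseteq> (*) (recip r) ` H + H"
    by (intro set_plus_mono2 D_subset_H) auto
  hence "card ((*) (recip r) ` H + D) \<le> card ((*) (recip r) ` H + H)"
    by (intro card_mono) (auto simp: finH finite_set_plus)
  also have "\<dots> = card ((*) r ` ((*) (recip r) ` H + H))"
    using assms set_plus_in[OF iH H_in] by (simp add: card_dilate)
  also have "(*) r ` ((*) (recip r) ` H + H) = H + (*) r ` H"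
    by (simp only: dilate_set_plus dilate_recip[OF assms(2,3) H_in])
  also have "H + (*) r ` H \<subseteq> H + (Z + H)" by (rule set_plus_mono2[OF order_refl Z(3)])
  hence "card (H + (*) r ` H) \<le> card (H + (Z + H))"
    using Z by (intro card_mono) (auto simp: finH finite_set_plus)
  also have "H + (Z + H) = Z + (H + H)" by (simp add: add_ac)
  also have "Z + (H + H) \<subseteq> Z + (W + H)" by (rule set_plus_mono2[OF order_refl W(3)])
  hence "card (Z + (H + H)) \<le> card (Z + (W + H))"
    using Z W by (intro card_mono) (auto simp: finH finite_set_plus)
  also have "Z + (W + H) = (Z + W) + H" by (simp add: add_ac)
  also have "card \<dots> \<le> card (Z + W) * card H"
    using Z W by (intro card_set_plus_le) (auto simp: finH finite_set_plus)
  finally have "real (card ((*) (recip r) ` H + D)) \<le> real (card (Z + W)) * real (card H)"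
    by (simp flip: of_nat_mult)
  also have "\<dots> \<le> K ^ (k + 17) * (K ^ 7 * real (card X))"
    using card_set_plus_power(2)[OF Z(1) W(1) Z(2) W(2)] card_H K0 by (intro mult_mono) auto
  also have "\<dots> = K ^ (k + 24) * real (card X)" by (simp add: power_add flip: mult.assoc)
  finally have "real (card ((*) (recip r) ` H + D)) \<le> K ^ (k + 24) * real (card X)" .
  from covering[OF _ this] show ?thesis unfolding good_def using finH by (simp add: add.commute)
qed

lemma good_if_small_sumset:
  assumes r: "r \<in> F" "r \<noteq> 0" and le: "real (card (X + (*) r ` X)) \<le> K * real (card X)"
  shows "good 29 r"
proof -
  have ir: "recip r \<in> F" "recip r \<noteq> 0" using r recip recip_nonzero by auto
  have iX: "(*) (recip r) ` X \<subseteq> F" using ir X_in by (intro dilate_in)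
  have "real (card ((*) r ` D + D)) \<le> 2 * K * real (card ((*) r ` D + X))"
    using finD by (intro card_plus_D) auto
  also have "card ((*) r ` D + X) = card ((*) r ` (D + (*) (recip r) ` X))"
    by (simp only: dilate_set_plus dilate_recip[OF r X_in])
  also have "\<dots> = card (D + (*) (recip r) ` X)"
    using r set_plus_in[OF D_in iX] by (simp add: card_dilate)
  also have "D + (*) (recip r) ` X = (*) (recip r) ` X + D" by (simp add: add.commute)
  also have "real (card \<dots>) \<le> 2 * K * real (card ((*) (recip r) ` X + X))"
    using finX by (intro card_plus_D) auto
  also have "card ((*) (recip r) ` X + X) = card ((*) r ` ((*) (recip r) ` X + X))"
    using r set_plus_in[OF iX X_in] by (simp add: card_dilate)
  also have "(*) r ` ((*) (recip r) ` X + X) = X + (*) r ` X"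
    by (simp only: dilate_set_plus dilate_recip[OF r X_in])
  finally have "real (card ((*) r ` D + D)) \<le> 2 * K * (2 * K * real (card (X + (*) r ` X)))"
    using K0 by (simp add: mult_left_mono)
  also have "\<dots> \<le> 2 * K * (2 * K * (K * real (card X)))"
    using K0 by (intro mult_left_mono le) auto
  also have "\<dots> = 2 * 2 * (K ^ 3 * real (card X))" by (simp add: power3_eq_cube)
  also have "\<dots> \<le> K * K * (K ^ 3 * real (card X))"
    using K2 by (intro mult_right_mono mult_mono) auto
  also have "\<dots> = K ^ 5 * real (card X)" by (simp add: eval_nat_numeral)
  finally have "real (card ((*) r ` D + D)) \<le> K ^ 5 * real (card X)" .
  from covering[OF _ this] obtain Z where Z: "finite Z" "real (card Z) \<le> K ^ 6" "(*) r ` D \<subseteq> Z + H"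
    using finD by auto
  obtain W where W: "finite W" "real (card W) \<le> K ^ 17" "H + H \<subseteq> W + H"
    using H_plus_H by blast
  have "(*) r ` H = (*) r ` D + (*) r ` D" by (simp add: H_def dilate_set_plus)
  also have "\<dots> \<subseteq> (Z + H) + (Z + H)" by (rule set_plus_mono2[OF Z(3) Z(3)])
  also have "\<dots> = Z + Z + (H + H)" by (simp add: add_ac)
  also have "\<dots> \<subseteq> Z + Z + (W + H)" by (rule set_plus_mono2[OF order_refl W(3)])
  finally have "(*) r ` H \<subseteq> Z + Z + W + H" by (simp add: add_ac)
  thus ?thesis
    using card_set_plus_power[OF card_set_plus_power(1)[OF Z(1) Z(1) Z(2) Z(2)] W(1)
          card_set_plus_power(2)[OF Z(1) Z(1) Z(2) Z(2)] W(2)]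
    unfolding good_def by auto
qed

text \<open>
  If \<open>r\<close> is good, then many elements of \<open>H\<close> go to a single translate of \<open>H\<close>, and their differences give
  many \<open>d \<noteq> 0\<close> with both \<open>d\<close> and \<open>r d\<close> in \<open>H + H\<close>. As \<open>d\<close> and \<open>r d\<close> determine \<open>r\<close>, double counting pairs
  in \<open>H + H\<close> leaves room for about \<open>|H|\<close> good elements only.
\<close>

lemma few_good:
  assumes T: "T \<subseteq> F" "\<And>r. r \<in> T \<Longrightarrow> good k r" and big: "2 * K ^ k \<le> real (card H)"
  shows "real (card T) \<le> K ^ (k + 42) * real (card X)"
proof -
  let ?h = "real (card H)"
  have h0: "0 < ?h" using cardX card_H_ge by linarith
  define P where "P = (H + H - {0}) \<times> (H + H)"
  have HH_in: "H + H \<subseteq> F" using H_in set_plus_in by blast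
  have "real (card T) * (?h / K ^ k - 1) \<le> real (card P)"
  proof (rule card_fibres_le[where h = "\<lambda>(d, x). x * recip d"])
    fix r assume r: "r \<in> T"
    obtain Z where Z: "finite Z" "real (card Z) \<le> K ^ k" "(*) r ` H \<subseteq> Z + H"
      using T(2)[OF r] unfolding good_def by blast
    define B where "B = (\<lambda>z. {h \<in> H. r * h - z \<in> H})"
    have "H \<subseteq> (\<Union>z\<in>Z. B z)"
    proof
      fix h assume h: "h \<in> H"
      then obtain z h' where "z \<in> Z" "h' \<in> H" "r * h = z + h'"
        using Z(3) by (fastforce simp: set_plus_def)
      thus "h \<in> (\<Union>z\<in>Z. B z)" using h by (auto simp: B_def intro!: bexI[of _ z])
    qed
    hence "card H \<le> card (\<Union>z\<in>Z. B z)"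
      using Z finH by (intro card_mono) (auto simp: B_def)
    also have "\<dots> \<le> (\<Sum>z\<in>Z. card (B z))" using Z(1) by (rule card_UN_le)
    finally have "?h \<le> (\<Sum>z\<in>Z. real (card (B z)))" by (simp flip: of_nat_sum)
    then obtain z where z: "z \<in> Z" "?h / K ^ k \<le> real (card (B z))"
      using exists_ge_average[OF Z(1,2) h0] by blast
    have "0 < ?h / K ^ k" using h0 K0 by simp
    hence "B z \<noteq> {}" using z(2) by auto
    then obtain h0 where h0: "h0 \<in> B z" by blast
    show "\<exists>(C :: 'a set) \<iota>. ?h / K ^ k - 1 \<le> real (card C) \<and> inj_on \<iota> C \<and>
            \<iota> ` C \<subseteq> {q \<in> P. (case q of (d, x) \<Rightarrow> x * recip d) = r}"
    proof (intro exI conjI)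
      have "card (B z - {h0}) = card (B z) - 1" using h0 finH by (simp add: B_def)
      moreover have "0 < card (B z)" using h0 finH by (auto simp: card_gt_0_iff B_def)
      ultimately show "?h / K ^ k - 1 \<le> real (card (B z - {h0}))" using z(2) by linarith
      show "inj_on (\<lambda>h. (h - h0, r * (h - h0))) (B z - {h0})" by (auto simp: inj_on_def)
      show "(\<lambda>h. (h - h0, r * (h - h0))) ` (B z - {h0}) \<subseteq> {q \<in> P. (case q of (d, x) \<Rightarrow> x * recip d) = r}"
      proof (rule image_subsetI)
        fix h assume "h \<in> B z - {h0}"
        hence h: "h \<in> B z" "h \<noteq> h0" by auto
        have neg: "- x \<in> H" if "x \<in> H" for x using that uminus_H by blast
        have "h + - h0 \<in> H + H" using h h0 neg by (intro set_plus_intro) (auto simp: B_def)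
        moreover have "(r * h - z) + - (r * h0 - z) \<in> H + H"
          using h h0 neg by (intro set_plus_intro neg) (auto simp: B_def)
        ultimately have mem: "h - h0 \<in> H + H" "r * (h - h0) \<in> H + H"
          by (simp_all add: algebra_simps)
        hence "h - h0 \<in> F" using HH_in by blast
        moreover have "r \<in> F" using r T by blast
        ultimately have "r * (h - h0) * recip (h - h0) = r"
          using h recip(2)[of "h - h0"] mult_e[of r] by (simp add: mult.assoc)
        thus "(h - h0, r * (h - h0)) \<in> {q \<in> P. (case q of (d, x) \<Rightarrow> x * recip d) = r}"
          using mem h by (auto simp: P_def)
      qed
    qed
  qed (auto simp: P_def finH finite_set_plus)
  also have "card P \<le> card (H + H) * card (H + H)"
    unfolding P_def card_cartesian_product by (intro mult_right_mono card_mono) (auto simp: finH finite_set_plus)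
  also have "real \<dots> \<le> (K ^ 17 * ?h) * (K ^ 17 * ?h)"
  proof -
    obtain W where W: "finite W" "real (card W) \<le> K ^ 17" "H + H \<subseteq> W + H"
      using H_plus_H by blast
    have "card (H + H) \<le> card (W + H)" using W finH by (intro card_mono) (auto simp: finite_set_plus)
    also have "\<dots> \<le> card W * card H" using W finH by (intro card_set_plus_le)
    finally have "real (card (H + H)) \<le> real (card W) * ?h" by (simp flip: of_nat_mult)
    also have "\<dots> \<le> K ^ 17 * ?h" using W by (intro mult_right_mono) auto
    finally show ?thesis using K0 by (auto intro!: mult_mono)
  qed
  finally have "real (card T) * (?h / K ^ k - 1) \<le> K ^ 34 * (?h * ?h)"
    by (simp add: mult_ac flip: power_add)
  moreover have "?h / (2 * K ^ k) \<le> ?h / K ^ k - 1"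
    using big K0 by (simp add: field_simps)
  hence "real (card T) * (?h / (2 * K ^ k)) \<le> real (card T) * (?h / K ^ k - 1)"
    by (intro mult_left_mono) auto
  ultimately have "real (card T) * (?h / (2 * K ^ k)) \<le> K ^ 34 * (?h * ?h)" by linarith
  hence "?h * real (card T) \<le> ?h * (2 * (K ^ k * K ^ 34 * ?h))"
    using K0 by (simp add: field_simps)
  hence "real (card T) \<le> 2 * (K ^ k * K ^ 34 * ?h)"
    using h0 by (subst (asm) mult_le_cancel_left_pos) auto
  also have "\<dots> \<le> K * (K ^ k * K ^ 34 * (K ^ 7 * real (card X)))"
    using K2 card_H by (intro mult_mono mult_left_mono) auto
  also have "\<dots> = K ^ (k + 42) * real (card X)" by (simp add: power_add eval_nat_numeral)
  finally show ?thesis .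
qed

text \<open>
  The quotients \<open>R\<close> of differences of \<open>S\<close> are good. If they exhaust \<open>F\<close>, everything is good. Otherwise, as
  \<open>e\<close> generates \<open>F\<close>, there is \<open>\<xi> = r + e\<close> outside \<open>R\<close> with \<open>r\<close> in \<open>R\<close>; then \<open>\<xi>\<close> is good too, and
  \<open>s + \<xi> t\<close> determines the pair \<open>(s, t)\<close>, since a coincidence would express \<open>\<xi>\<close> as an element of \<open>R\<close>.
\<close>

lemma pivot:
  assumes S: "S \<subseteq> F" "\<And>s. s \<in> S \<Longrightarrow> good 29 s" "2 \<le> card S"
  shows "\<exists>T\<subseteq>F. (\<forall>r\<in>T. good 267 r) \<and> (T = F \<or> card T = card S * card S)"
proof -
  define R where "R = {(s1 - s2) * recip (s3 - s4) | s1 s2 s3 s4. s1 \<in> S \<and> s2 \<in> S \<and> s3 \<in> S \<and> s4 \<in> S \<and> s3 \<noteq> s4}"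
  obtain s s' where ss': "s \<in> S" "s' \<in> S" "s \<noteq> s'"
    using S(3) by (metis card_le_Suc0_iff_eq card.infinite not_less_eq_eq numeral_2_eq_2 zero_le)
  have R_in: "R \<subseteq> F"
    using S(1) by (auto simp: R_def intro!: mult_in diff_in recip)
  have goodR: "good 175 r" if r: "r \<in> R" for r
  proof -
    obtain s1 s2 s3 s4 where s: "s1 \<in> S" "s2 \<in> S" "s3 \<in> S" "s4 \<in> S" "s3 \<noteq> s4" "r = (s1 - s2) * recip (s3 - s4)"
      using r by (auto simp: R_def)
    have d: "good 75 (s1 - s2)" "good 75 (s3 - s4)" using good_diff[OF S(2) S(2)] s by fastforce+
    have "good (75 + 25) (recip (s3 - s4))" using d s S(1) by (intro good_recip) (auto intro: diff_in)
    from good_mult[OF d(1) this] show ?thesis using s by simp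
  qed
  show ?thesis
  proof (cases "F \<subseteq> R")
    case True
    thus ?thesis using goodR good_mono[of 175 _ 267] by (intro exI[of _ F]) auto
  next
    case False
    have "(s - s) * recip (s - s') \<in> R" using ss' unfolding R_def by blast
    hence "0 \<in> R" by simp
    then obtain r where r: "r \<in> R" "r + e \<notin> R" using generated[of R] False by blast
    define \<xi> where "\<xi> = r + e"
    have \<xi>: "\<xi> \<in> F" "\<xi> \<notin> R" "good 192 \<xi>"
      using r R_in e_in add_in good_add[OF goodR good_e, of r] by (auto simp: \<xi>_def)
    define T where "T = (\<lambda>(s, t). s + \<xi> * t) ` (S \<times> S)"
    have "inj_on (\<lambda>(s, t). s + \<xi> * t) (S \<times> S)"
    proof (rule inj_onI, clarify)
      fix a b c d assume m: "a \<in> S" "b \<in> S" "c \<in> S" "d \<in> S" and eq: "a + \<xi> * b = c + \<xi> * d"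
      have "b = d"
      proof (rule ccontr)
        assume "b \<noteq> d"
        hence bd: "b - d \<in> F" "b - d \<noteq> 0" using m S(1) diff_in by auto
        have "\<xi> * (b - d) = c - a" using eq by (simp add: algebra_simps)
        hence "(c - a) * recip (b - d) = \<xi> * ((b - d) * recip (b - d))" by (metis mult.assoc)
        also have "\<dots> = \<xi>" using bd \<xi> by (simp add: recip mult_e)
        finally have "\<xi> \<in> R" using m \<open>b \<noteq> d\<close> unfolding R_def by blast
        thus False using \<xi> by simp
      qed
      thus "a = c \<and> b = d" using eq by simp
    qed
    hence "card T = card S * card S" by (simp add: T_def card_image card_cartesian_product)
    moreover have "T \<subseteq> F" using S(1) \<xi> by (auto simp: T_def intro!: add_in mult_in)
    moreover have "good 267 x" if x: "x \<in> T" for x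
    proof -
      obtain a b where ab: "a \<in> S" "b \<in> S" "x = a + \<xi> * b" using x by (auto simp: T_def)
      have "good (29 + (192 + 29) + 17) x" unfolding ab(3)
        by (intro good_add good_mult S ab \<xi>)
      thus ?thesis by simp
    qed
    ultimately show ?thesis by blast
  qed
qed

end

text \<open>
  The sum-product phenomenon: a set of small doubling cannot be close to about as many of its dilates as it
  has elements, unless its size is bounded or nearly that of the field. By \<open>pivot\<close> such dilations would
  yield \<open>|S|\<^sup>2\<close> or \<open>|F|\<close> good elements, which is more than \<open>few_good\<close> permits.
\<close>

lemma (in prime_field_in_ring) small_dilate_sums:
  fixes X S :: "'a set" and K :: real
  assumes X: "X \<subseteq> F" "X \<noteq> {}" and K: "2 \<le> K"
    and XX: "real (card (X + uminus ` X)) \<le> K * real (card X)"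
    and S: "S \<subseteq> F - {0}" "real (card X) \<le> K * real (card S)"
    and XS: "\<And>s. s \<in> S \<Longrightarrow> real (card (X + (*) s ` X)) \<le> K * real (card X)"
  shows "real (card X) \<le> K ^ 311 \<or> real (card F) \<le> K ^ 311 * real (card X)"
proof -
  have "finite X" using X finF finite_subset by blast
  then interpret small_doubling_in_field F e X K
    using assms by unfold_locales auto
  let ?m = "real (card X)"
  consider "card S < 2" | "real (card H) < 2 * K ^ 267" | "2 \<le> card S" "2 * K ^ 267 \<le> real (card H)"
    by linarith
  thus ?thesis
  proof cases
    case 1
    hence "?m \<le> K * 1" using S K0 by (intro order_trans[OF S(2)] mult_left_mono) auto
    also have "\<dots> \<le> K ^ 311" using K2 power_increasing[of 1 311 K] by simp
    finally show ?thesis by simp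
  next
    case 2
    hence "?m \<le> 2 * 2 * K ^ 267" using card_H_ge by simp
    also have "\<dots> \<le> K * K * K ^ 267" using K2 by (intro mult_right_mono mult_mono) auto
    also have "\<dots> = K ^ 269" using power_add[of K 2 267] by (simp add: power2_eq_square)
    also have "\<dots> \<le> K ^ 311" using K2 by (intro power_increasing) auto
    finally show ?thesis by simp
  next
    case 3
    have "good 29 s" if "s \<in> S" for s
      using that S XS by (intro good_if_small_sumset) auto
    then obtain T where T: "T \<subseteq> F" "\<And>r. r \<in> T \<Longrightarrow> good 267 r" "T = F \<or> card T = card S * card S"
      using pivot[of S] S 3 by blast
    have cT: "real (card T) \<le> K ^ 309 * ?m" using few_good[OF T(1,2) 3(2)] by simp
    show ?thesis
    proof (cases "T = F")
      case True
      have "K ^ 309 * ?m \<le> K ^ 311 * ?m" using K2 by (intro mult_right_mono power_increasing) auto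
      thus ?thesis using cT True by simp
    next
      case False
      hence "real (card S) * real (card S) \<le> K ^ 309 * ?m" using T(3) cT by simp
      hence "K * K * (real (card S) * real (card S)) \<le> K * K * (K ^ 309 * ?m)"
        using K0 by (intro mult_left_mono) auto
      moreover have "?m * ?m \<le> (K * real (card S)) * (K * real (card S))"
        using S K0 by (intro mult_mono) auto
      moreover have "K * K * (K ^ 309 * ?m) = K ^ 311 * ?m"
        using power_add[of K 2 309] by (simp add: power2_eq_square)
      moreover have "(K * real (card S)) * (K * real (card S)) = K * K * (real (card S) * real (card S))"
        by simp
      ultimately have "?m * ?m \<le> K ^ 311 * ?m" by linarith
      thus ?thesis using cardX by simp
    qed
  qed
qed

section \<open>From dense graphs to dilations\<close>

text \<open>
  By Cauchy-Schwarz the average intersection of two sets of the family is at least the square of their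
  density.
\<close>

lemma many_large_intersections:
  fixes W :: "'t \<Rightarrow> 'w set" and N \<kappa> :: real
  assumes fin: "finite T" "T \<noteq> {}" "finite \<Omega>" and N: "real (card \<Omega>) \<le> N" "0 < N" and \<kappa>: "0 < \<kappa>"
    and W: "\<And>t. t \<in> T \<Longrightarrow> W t \<subseteq> \<Omega>" "\<And>t. t \<in> T \<Longrightarrow> N / \<kappa> \<le> real (card (W t))"
  shows "\<exists>t0\<in>T. real (card T) / (2 * \<kappa>\<^sup>2) \<le> real (card {t \<in> T. N / (2 * \<kappa>\<^sup>2) \<le> real (card (W t \<inter> W t0))})"
proof -
  define c where "c = (\<lambda>w. real (card {t \<in> T. w \<in> W t}))"
  let ?n = "real (card T)"
  have n0: "0 < ?n" using fin by (simp add: card_gt_0_iff)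
  have eq: "{w \<in> \<Omega>. w \<in> W t} = W t" if "t \<in> T" for t using W(1)[OF that] by blast
  have eq2: "{w \<in> W t0. w \<in> W t} = W t \<inter> W t0" for t t0 by blast
  have "?n * (N / \<kappa>) \<le> (\<Sum>t\<in>T. real (card {w \<in> \<Omega>. w \<in> W t}))"
    by (rule sum_bounded_below) (use W eq in auto)
  also have "\<dots> = (\<Sum>w\<in>\<Omega>. c w)" unfolding c_def by (rule double_count[OF fin(1,3)])
  finally have "(?n * (N / \<kappa>))\<^sup>2 \<le> (\<Sum>w\<in>\<Omega>. c w)\<^sup>2" using N \<kappa> by (intro power_mono) auto
  also have "\<dots> \<le> N * (\<Sum>w\<in>\<Omega>. (c w)\<^sup>2)" by (rule sum_square_le) fact
  finally have "N * (?n * (?n * N / \<kappa>\<^sup>2)) \<le> N * (\<Sum>w\<in>\<Omega>. (c w)\<^sup>2)"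
    by (simp add: power2_eq_square field_simps)
  hence "?n * (?n * N / \<kappa>\<^sup>2) \<le> (\<Sum>w\<in>\<Omega>. (c w)\<^sup>2)" using N by (subst (asm) mult_le_cancel_left_pos) auto
  also have "\<dots> = (\<Sum>w\<in>\<Omega>. \<Sum>t0\<in>{t \<in> T. w \<in> W t}. c w)"
    by (simp add: c_def power2_eq_square)
  also have "\<dots> = (\<Sum>t0\<in>T. \<Sum>w\<in>{w \<in> \<Omega>. w \<in> W t0}. c w)"
    by (rule sum.swap_restrict[OF fin(3,1)])
  also have "\<dots> = (\<Sum>t0\<in>T. \<Sum>w\<in>W t0. c w)" by (intro sum.cong eq refl) auto
  also have "\<dots> = (\<Sum>t0\<in>T. \<Sum>t\<in>T. real (card (W t \<inter> W t0)))"
  proof (rule sum.cong)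
    fix t0 assume "t0 \<in> T"
    hence "finite (W t0)" using W(1) fin finite_subset by blast
    from double_count[OF this fin(1), of "\<lambda>w t. w \<in> W t"]
    show "(\<Sum>w\<in>W t0. c w) = (\<Sum>t\<in>T. real (card (W t \<inter> W t0)))"
      by (simp add: c_def eq2)
  qed simp
  finally obtain t0 where t0: "t0 \<in> T" "?n * (?n * N / \<kappa>\<^sup>2) / ?n \<le> (\<Sum>t\<in>T. real (card (W t \<inter> W t0)))"
    using exists_ge_average[OF fin(1) order_refl, of "?n * (?n * N / \<kappa>\<^sup>2)"] N \<kappa> n0 by auto
  define T1 where "T1 = {t \<in> T. N / (2 * \<kappa>\<^sup>2) \<le> real (card (W t \<inter> W t0))}"
  have "?n * N / \<kappa>\<^sup>2 \<le> (\<Sum>t\<in>T. real (card (W t \<inter> W t0)))" using t0 n0 by simp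
  also have "\<dots> \<le> (\<Sum>t\<in>T. (if t \<in> T1 then N else 0) + N / (2 * \<kappa>\<^sup>2))"
  proof (rule sum_mono)
    fix t assume t: "t \<in> T"
    have "card (W t \<inter> W t0) \<le> card \<Omega>" using W(1)[OF t] fin by (intro card_mono) auto
    hence "real (card (W t \<inter> W t0)) \<le> N" using N by linarith
    thus "real (card (W t \<inter> W t0)) \<le> (if t \<in> T1 then N else 0) + N / (2 * \<kappa>\<^sup>2)"
      using t N \<kappa> by (auto simp: T1_def intro: add_increasing2)
  qed
  also have "\<dots> = real (card T1) * N + ?n * (N / (2 * \<kappa>\<^sup>2))"
    using fin by (simp add: sum.distrib T1_def flip: sum.inter_filter)
  finally have "N * (?n / (2 * \<kappa>\<^sup>2)) \<le> N * real (card T1)"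
    using \<kappa> by (simp add: field_simps)
  hence "?n / (2 * \<kappa>\<^sup>2) \<le> real (card T1)" using N by (subst (asm) mult_le_cancel_left_pos) auto
  thus ?thesis using t0 by (auto simp: T1_def)
qed

lemma le_div_trans:
  fixes x y K :: real
  assumes "x * (M / K ^ j) \<le> K ^ i * M * M" "0 < M" "0 < K"
  shows "x \<le> K ^ (i + j) * M"
proof -
  have "K ^ i * M * M = (K ^ (i + j) * M) * (M / K ^ j)" using assms by (simp add: field_simps power_add)
  hence "x * (M / K ^ j) \<le> (K ^ (i + j) * M) * (M / K ^ j)" using assms by simp
  thus ?thesis using assms by (subst (asm) mult_le_cancel_right_pos) auto
qed

context prime_field_in_ring
begin

text \<open>
  For each \<open>s\<close> the Balog-Szemeredi-Gowers theorem gives \<open>A s\<close> and \<open>V s\<close> in \<open>U\<close> with a small sumset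
  \<open>A s + s V s\<close>. These sets depend on \<open>s\<close>, but for a suitable \<open>s0\<close> the products \<open>A s \<times> V s\<close> and
  \<open>A s0 \<times> V s0\<close> have a large intersection for many \<open>s\<close>. The triangle inequality then passes from \<open>X = A s0\<close>
  to \<open>s V\<close> and from there to \<open>r X\<close>, where \<open>V\<close> is the common part of \<open>V s\<close> and \<open>V s0\<close> and \<open>r = - s / s0\<close> takes
  \<open>s0 V\<close> to \<open>- s V\<close>.
\<close>

lemma dense_dilate_graphs:
  fixes U T :: "'a set" and M K :: real
  assumes U: "U \<subseteq> F" "real (card U) \<le> M" and M: "0 < M" and K: "2 \<le> K"
    and T: "T \<subseteq> F - {0}" "M / K \<le> real (card T)"
    and G: "\<And>s. s \<in> T \<Longrightarrow> \<exists>G\<subseteq>U \<times> U. M\<^sup>2 / K \<le> real (card G) \<and> real (card ((\<lambda>(v, w). v + s * w) ` G)) \<le> M"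
  shows "M \<le> K ^ 70000 \<or> real (card F) \<le> K ^ 70000 * M"
proof -
  have K0: "0 < K" and K1: "1 \<le> K" using K by auto
  have fU: "finite U" using U finF finite_subset by blast
  have "\<exists>A V. A \<subseteq> U \<and> V \<subseteq> U \<and> M / K ^ 11 \<le> real (card A) \<and> M / K ^ 11 \<le> real (card V) \<and>
          real (card (A + (*) s ` V)) \<le> K ^ 28 * M" if s: "s \<in> T" for s
  proof -
    have sF: "s \<in> F" "s \<noteq> 0" using s T by auto
    obtain G where G: "G \<subseteq> U \<times> U" "M\<^sup>2 / K \<le> real (card G)" "real (card ((\<lambda>(v, w). v + s * w) ` G)) \<le> M"
      using G[OF s] by blast
    define G' where "G' = (\<lambda>(v, w). (v, s * w)) ` G"
    have "inj_on (\<lambda>(v, w). (v, s * w)) G"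
      using G(1) U sF by (auto simp: inj_on_def mult_left_cancel subset_iff)
    hence "card G' = card G" by (simp add: G'_def card_image)
    moreover have "(\<lambda>(a, b). a + b) ` G' = (\<lambda>(v, w). v + s * w) ` G"
      by (simp add: G'_def image_image case_prod_unfold)
    moreover have "G' \<subseteq> U \<times> (*) s ` U" using G(1) by (auto simp: G'_def)
    moreover have "real (card ((*) s ` U)) \<le> M" using U sF by (simp add: card_dilate)
    ultimately have "\<exists>A\<subseteq>U. \<exists>B\<subseteq>(*) s ` U. M / K ^ 11 \<le> real (card A) \<and> M / K ^ 11 \<le> real (card B) \<and>
        real (card (A + B)) \<le> K ^ 28 * M"
      using fU U M K G by (intro balog_szemeredi_gowers[where G = G']) auto
    then obtain A B where AB: "A \<subseteq> U" "B \<subseteq> (*) s ` U" "M / K ^ 11 \<le> real (card A)"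
      "M / K ^ 11 \<le> real (card B)" "real (card (A + B)) \<le> K ^ 28 * M" by blast
    obtain V where V: "V \<subseteq> U" "B = (*) s ` V" using AB(2) by (meson subset_imageE)
    have "card B = card V" using V U sF by (simp add: card_dilate)
    thus ?thesis using AB V by (intro exI[of _ A] exI[of _ V]) simp
  qed
  hence "\<forall>s\<in>T. \<exists>A V. A \<subseteq> U \<and> V \<subseteq> U \<and> M / K ^ 11 \<le> real (card A) \<and> M / K ^ 11 \<le> real (card V) \<and>
          real (card (A + (*) s ` V)) \<le> K ^ 28 * M" by blast
  from bchoice[OF this] obtain A where "\<forall>s\<in>T. \<exists>V. A s \<subseteq> U \<and> V \<subseteq> U \<and> M / K ^ 11 \<le> real (card (A s)) \<and>
      M / K ^ 11 \<le> real (card V) \<and> real (card (A s + (*) s ` V)) \<le> K ^ 28 * M" by blast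
  from bchoice[OF this] obtain V where AV: "\<And>s. s \<in> T \<Longrightarrow> A s \<subseteq> U" "\<And>s. s \<in> T \<Longrightarrow> V s \<subseteq> U"
    "\<And>s. s \<in> T \<Longrightarrow> M / K ^ 11 \<le> real (card (A s))" "\<And>s. s \<in> T \<Longrightarrow> M / K ^ 11 \<le> real (card (V s))"
    "\<And>s. s \<in> T \<Longrightarrow> real (card (A s + (*) s ` V s)) \<le> K ^ 28 * M"
    by blast
  have fT: "finite T" by (rule finite_subset[OF T(1)]) (use finF in auto)
  have "0 < M / K" using M K0 by simp
  hence Tne: "T \<noteq> {}" using T(2) by auto
  have finAV: "finite (A s)" "finite (V s)" if "s \<in> T" for s
    using finite_subset[OF AV(1) fU] finite_subset[OF AV(2) fU] that by auto
  have K44: "(K ^ 22)\<^sup>2 = K ^ 44" by (simp flip: power_mult)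
  \<comment> \<open>two sets of density \<open>K\<^bsup>-11\<^esup>\<close> give a product of density \<open>K\<^bsup>-22\<^esup>\<close>\<close>
  have "\<exists>t0\<in>T. real (card T) / (2 * (K ^ 22)\<^sup>2)
      \<le> real (card {t \<in> T. M\<^sup>2 / (2 * (K ^ 22)\<^sup>2) \<le> real (card (A t \<times> V t \<inter> A t0 \<times> V t0))})"
  proof (rule many_large_intersections[OF fT Tne, where \<Omega> = "U \<times> U"])
    show "real (card (U \<times> U)) \<le> M\<^sup>2"
      using U M by (simp add: card_cartesian_product power2_eq_square mult_mono)
    show "M\<^sup>2 / K ^ 22 \<le> real (card (A t \<times> V t))" if t: "t \<in> T" for t
    proof -
      have "M\<^sup>2 / K ^ 22 = (M / K ^ 11) * (M / K ^ 11)" by (simp add: power2_eq_square flip: power_add)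
      also have "\<dots> \<le> real (card (A t)) * real (card (V t))"
        using AV(3,4)[OF t] M K0 by (intro mult_mono) auto
      finally show ?thesis by (simp add: card_cartesian_product)
    qed
    show "A t \<times> V t \<subseteq> U \<times> U" if t: "t \<in> T" for t
      using AV(1,2)[OF t] by (rule Sigma_mono)
  qed (use fU M K0 in auto)
  then obtain s0 where s0: "s0 \<in> T"
    "real (card T) / (2 * K ^ 44) \<le> real (card {t \<in> T. M\<^sup>2 / (2 * K ^ 44) \<le> real (card (A t \<times> V t \<inter> A s0 \<times> V s0))})"
    unfolding K44 by blast
  define T1 where "T1 = {t \<in> T. M\<^sup>2 / (2 * K ^ 44) \<le> real (card (A t \<times> V t \<inter> A s0 \<times> V s0))}"
  have s0F: "s0 \<in> F" "s0 \<noteq> 0" using s0 T by auto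
  have "M / K ^ 46 = M / K / (K * K ^ 44)" by (simp flip: power_Suc power_Suc2)
  also have "\<dots> \<le> M / K / (2 * K ^ 44)" using K M by (intro divide_left_mono mult_right_mono) auto
  also have "\<dots> \<le> real (card T) / (2 * K ^ 44)" using T K0 by (intro divide_right_mono) auto
  also have "\<dots> \<le> real (card T1)" using s0 by (simp add: T1_def)
  finally have cT1: "M / K ^ 46 \<le> real (card T1)" .
  define X where "X = A s0"
  have X: "X \<subseteq> U" "finite X" "M / K ^ 11 \<le> real (card X)"
    using AV s0 finAV by (auto simp: X_def)
  have XM: "real (card X) \<le> M" using card_mono[OF fU X(1)] U by linarith
  have MX: "M \<le> K ^ 11 * real (card X)" using X(3) K0 by (simp add: field_simps)
  have V0: "V s0 \<subseteq> U" "finite (V s0)" "M / K ^ 11 \<le> real (card (V s0))" using AV s0 finAV by auto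
  have sum0: "real (card (X + (*) s0 ` V s0)) \<le> K ^ 28 * M" using AV s0 by (simp add: X_def)
  have "uminus ` (*) s0 ` V s0 + uminus ` X = uminus ` (X + (*) s0 ` V s0)"
    by (simp add: uminus_set_plus add.commute)
  hence "card (uminus ` (*) s0 ` V s0 + uminus ` X) = card (X + (*) s0 ` V s0)"
    by (simp add: card_image)
  moreover have "card ((*) s0 ` V s0) = card (V s0)" using s0F V0 U by (intro card_dilate) auto
  ultimately have "real (card (X + uminus ` X)) * real (card (V s0))
      \<le> real (card (X + (*) s0 ` V s0)) * real (card (X + (*) s0 ` V s0))"
    using ruzsa_triangle[of X "(*) s0 ` V s0" "uminus ` X"] X V0 by simp
  also have "\<dots> \<le> (K ^ 28 * M) * (K ^ 28 * M)" using sum0 K0 M by (intro mult_mono) auto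
  also have "\<dots> = K ^ 56 * M * M" by (simp add: mult_ac flip: power_add)
  finally have "real (card (X + uminus ` X)) * real (card (V s0)) \<le> K ^ 56 * M * M" .
  moreover have "real (card (X + uminus ` X)) * (M / K ^ 11) \<le> real (card (X + uminus ` X)) * real (card (V s0))"
    using V0 by (intro mult_left_mono) auto
  ultimately have XX: "real (card (X + uminus ` X)) \<le> K ^ 67 * M"
    using le_div_trans[of "real (card (X + uminus ` X))" M K 11 56] M K0 by simp
  have XrX: "real (card (X + (*) (- s * recip s0) ` X)) \<le> K ^ 213 * M" if s: "s \<in> T1" for s
  proof -
    have sT: "s \<in> T" and sF: "s \<in> F" "s \<noteq> 0" using s T by (auto simp: T1_def)
    define X' where "X' = A s \<inter> X"
    define V' where "V' = V s \<inter> V s0"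
    have sub: "X' \<subseteq> U" "V' \<subseteq> U" "finite X'" "finite V'"
      using X V0 by (auto simp: X'_def V'_def)
    have sizes: "real (card X') \<le> M" "real (card V') \<le> M"
      using card_mono[OF fU sub(1)] card_mono[OF fU sub(2)] U by linarith+
    have "A s \<times> V s \<inter> A s0 \<times> V s0 = X' \<times> V'" by (auto simp: X'_def V'_def X_def)
    hence "M\<^sup>2 / (2 * K ^ 44) \<le> real (card X') * real (card V')"
      using s by (simp add: T1_def card_cartesian_product)
    moreover have "M\<^sup>2 / K ^ 45 \<le> M\<^sup>2 / (2 * K ^ 44)"
      using K power_Suc[of K 44] by (intro divide_left_mono) auto
    ultimately have prod: "M * (M / K ^ 45) \<le> real (card X') * real (card V')"
      by (simp add: power2_eq_square)
    have "M * (M / K ^ 45) \<le> M * real (card V')"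
      using prod sizes mult_right_mono[OF sizes(1), of "real (card V')"] by linarith
    hence cV': "M / K ^ 45 \<le> real (card V')" using M by (subst (asm) mult_le_cancel_left_pos) auto
    have "M * (M / K ^ 45) \<le> M * real (card X')"
      using prod sizes mult_left_mono[OF sizes(2), of "real (card X')"] by (simp add: mult.commute)
    hence cX': "M / K ^ 45 \<le> real (card X')" using M by (subst (asm) mult_le_cancel_left_pos) auto
    have "uminus ` uminus ` X' = X'" by (simp add: image_image)
    hence "real (card (X + (*) s ` V')) * real (card X')
        \<le> real (card (X + uminus ` X')) * real (card (X' + (*) s ` V'))"
      using ruzsa_triangle[of X "uminus ` X'" "(*) s ` V'"] X sub by (simp add: card_image)
    also have "\<dots> \<le> (K ^ 67 * M) * (K ^ 28 * M)"
    proof (intro mult_mono)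
      have "card (X + uminus ` X') \<le> card (X + uminus ` X)"
        using X by (intro card_mono set_plus_mono2 image_mono) (auto simp: X'_def finite_set_plus)
      thus "real (card (X + uminus ` X')) \<le> K ^ 67 * M" using XX by linarith
      have "card (X' + (*) s ` V') \<le> card (A s + (*) s ` V s)"
        using finAV[OF sT] by (intro card_mono set_plus_mono2 image_mono) (auto simp: X'_def V'_def finite_set_plus)
      thus "real (card (X' + (*) s ` V')) \<le> K ^ 28 * M" using AV(5)[OF sT] by linarith
    qed (use K0 M in auto)
    also have "\<dots> = K ^ 95 * M * M" by (simp add: mult_ac flip: power_add)
    finally have "real (card (X + (*) s ` V')) * real (card X') \<le> K ^ 95 * M * M" .
    moreover have "real (card (X + (*) s ` V')) * (M / K ^ 45) \<le> real (card (X + (*) s ` V')) * real (card X')"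
      using cX' by (intro mult_left_mono) auto
    ultimately have XsV: "real (card (X + (*) s ` V')) \<le> K ^ 140 * M"
      using le_div_trans[of "real (card (X + (*) s ` V'))" M K 45 95] M K0 by simp
    define r where "r = - s * recip s0"
    have rF: "r \<in> F" "r \<noteq> 0"
    proof -
      show "r \<in> F" using sF s0F by (auto simp: r_def intro!: mult_in uminus_in recip)
      have "r * s0 = - (s * (s0 * recip s0))" by (simp add: r_def mult_ac)
      also have "\<dots> = - s" using sF s0F by (simp add: recip mult_e)
      finally show "r \<noteq> 0" using sF by auto
    qed
    have rs0: "r * (s0 * x) = - (s * x)" if "x \<in> F" for x
    proof -
      have "r * (s0 * x) = - (s * (recip s0 * (s0 * x)))" by (simp add: r_def mult_ac)
      thus ?thesis using s0F that by (simp add: recip_mult_cancel)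
    qed
    have "uminus ` (*) s ` V' = (*) r ` (*) s0 ` V'"
      unfolding image_image using rs0 sub U by (intro image_cong) auto
    hence "uminus ` (*) s ` V' + (*) r ` X = (*) r ` ((*) s0 ` V' + X)" by (simp add: dilate_set_plus)
    also have "card \<dots> = card ((*) s0 ` V' + X)"
      using rF s0F sub U X by (intro card_dilate set_plus_in dilate_in) auto
    also have "\<dots> \<le> card (X + (*) s0 ` V s0)"
      using X V0 by (subst add.commute, intro card_mono set_plus_mono2 image_mono) (auto simp: V'_def finite_set_plus)
    finally have le28: "real (card (uminus ` (*) s ` V' + (*) r ` X)) \<le> K ^ 28 * M" using sum0 by linarith
    have "card ((*) s ` V') = card V'" using sF sub U by (intro card_dilate) auto
    hence "real (card (X + (*) r ` X)) * real (card V')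
        \<le> real (card (X + (*) s ` V')) * real (card (uminus ` (*) s ` V' + (*) r ` X))"
      using ruzsa_triangle[of X "(*) s ` V'" "(*) r ` X"] X sub by simp
    also have "\<dots> \<le> (K ^ 140 * M) * (K ^ 28 * M)" using XsV le28 K0 M by (intro mult_mono) auto
    also have "\<dots> = K ^ 168 * M * M" by (simp add: mult_ac flip: power_add)
    finally have "real (card (X + (*) r ` X)) * real (card V') \<le> K ^ 168 * M * M" .
    moreover have "real (card (X + (*) r ` X)) * (M / K ^ 45) \<le> real (card (X + (*) r ` X)) * real (card V')"
      using cV' by (intro mult_left_mono) auto
    ultimately show ?thesis
      using le_div_trans[of "real (card (X + (*) r ` X))" M K 45 168] M K0 by (simp add: r_def)
  qed
  define S where "S = (\<lambda>s. - s * recip s0) ` T1"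
  have T1F: "T1 \<subseteq> F - {0}" using T by (auto simp: T1_def)
  have r0: "recip s0 \<in> F" "recip s0 \<noteq> 0" using s0F recip recip_nonzero by auto
  have uT1: "uminus ` T1 \<subseteq> F - {0}" using T1F uminus_in by auto
  have S_eq: "S = (*) (recip s0) ` uminus ` T1"
    unfolding S_def image_image by (intro image_cong refl mult.commute)
  have "card S = card (uminus ` T1)" unfolding S_eq using r0 uT1 by (intro card_dilate) auto
  also have "\<dots> = card T1" by (intro card_image) simp
  finally have cS: "card S = card T1" .
  have SF: "S \<subseteq> F - {0}"
  proof
    fix x assume "x \<in> S"
    then obtain t where t: "t \<in> F" "t \<noteq> 0" "x = recip s0 * t" using uT1 unfolding S_eq by blast
    have "x \<in> F" unfolding t(3) by (rule mult_in[OF r0(1) t(1)])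
    moreover have "x \<noteq> 0"
      using mult_left_cancel[OF r0 t(1) zero_in] t(2) unfolding t(3) mult_zero_right by blast
    ultimately show "x \<in> F - {0}" by blast
  qed
  have pow: "K ^ 213 * M \<le> K ^ 224 * real (card X)"
  proof -
    have "K ^ 213 * M \<le> K ^ 213 * (K ^ 11 * real (card X))" using MX K0 by (intro mult_left_mono) auto
    also have "\<dots> = K ^ 224 * real (card X)" by (simp flip: power_add mult.assoc)
    finally show ?thesis .
  qed
  have "real (card X) \<le> (K ^ 224) ^ 311 \<or> real (card F) \<le> (K ^ 224) ^ 311 * real (card X)"
  proof (rule small_dilate_sums[of X "K ^ 224" S])
    show "X \<subseteq> F" using X U by blast
    show "X \<noteq> {}" using MX M by auto
    have "K ^ 1 \<le> K ^ 224" using K1 by (intro power_increasing) auto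
    thus "2 \<le> K ^ 224" using K by simp
    have "K ^ 67 * M \<le> K ^ 213 * M" using K1 M by (intro mult_right_mono power_increasing) auto
    thus "real (card (X + uminus ` X)) \<le> K ^ 224 * real (card X)" using XX pow by linarith
    show "S \<subseteq> F - {0}" by fact
    have "M \<le> K ^ 46 * real (card S)" using cT1 K0 cS by (simp add: field_simps)
    moreover have "K ^ 46 * real (card S) \<le> K ^ 224 * real (card S)"
      using K1 by (intro mult_right_mono power_increasing) auto
    ultimately show "real (card X) \<le> K ^ 224 * real (card S)" using XM by linarith
    fix r assume "r \<in> S"
    then obtain s where s: "s \<in> T1" "r = - s * recip s0" by (auto simp: S_def)
    thus "real (card (X + (*) r ` X)) \<le> K ^ 224 * real (card X)" using XrX[OF s(1)] pow by simp
  qed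
  moreover have "(K ^ 224) ^ 311 = K ^ 69664" using power_mult[of K 224 311] by simp
  ultimately consider "real (card X) \<le> K ^ 69664" | "real (card F) \<le> K ^ 69664 * real (card X)" by auto
  thus ?thesis
  proof cases
    case 1
    have "M \<le> K ^ 11 * real (card X)" by fact
    also have "\<dots> \<le> K ^ 11 * K ^ 69664" using 1 K0 by (intro mult_left_mono) auto
    also have "\<dots> = K ^ (11 + 69664)" by (rule power_add[symmetric])
    also have "\<dots> \<le> K ^ 70000" using K1 by (intro power_increasing) auto
    finally show ?thesis by simp
  next
    case 2
    also have "K ^ 69664 * real (card X) \<le> K ^ 70000 * M"
      using K1 XM by (intro mult_mono power_increasing) auto
    finally show ?thesis by simp
  qed
qed

section \<open>Families of affine maps\<close>

lemma slope_unique: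
  assumes "r \<in> F" "r \<noteq> 0" "m \<in> F" "x \<in> F" "m * r = x"
  shows "m = x * recip r"
proof -
  have "x * recip r = m * (r * recip r)" unfolding assms(5)[symmetric] by (rule mult.assoc)
  thus ?thesis using assms by (simp add: recip mult_e)
qed

text \<open>
  Let \<open>\<phi>\<^sub>i(y) = b i + a i * y\<close>. If \<open>U\<close> is small, then by averaging there are \<open>u \<noteq> u'\<close> in \<open>U\<close> such that for many
  \<open>w\<close> in \<open>U\<close>, many images \<open>\<phi>\<^sub>i(Y)\<close> contain all of \<open>u, u', w\<close>. The composite \<open>\<psi> = \<phi>\<^sub>j \<circ> \<phi>\<^sub>i\<^sup>-\<^sup>1\<close> sends these
  three points to \<open>U\<close> and respects the affine relation \<open>u + s u' = (1 + s) w\<close>, so \<open>\<psi> u + s \<psi> u'\<close> lies in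
  \<open>(1 + s) U\<close>. An affine map is determined by its values at \<open>u\<close> and \<open>u'\<close>, so the pairs \<open>(\<psi> u, \<psi> u')\<close> form
  a dense subset of \<open>U \<times> U\<close> as long as at most \<open>K\<close> of the pairs \<open>(i, j)\<close> give the same composite. The
  relation \<open>bad\<close> sets aside pairs, such as \<open>i = j\<close>, for which the same composite may come up too often.
\<close>

lemma rich_ratios:
  fixes U Y :: "'a set" and I :: "'i set" and a b :: "'i \<Rightarrow> 'a" and bad :: "'i \<Rightarrow> 'i \<Rightarrow> bool" and K :: real
  defines "M \<equiv> real (card U)"
  assumes U: "U \<subseteq> F" and Y: "Y \<subseteq> F" and I: "finite I"
    and ab: "\<And>i. i \<in> I \<Longrightarrow> a i \<in> F - {0}" "\<And>i. i \<in> I \<Longrightarrow> b i \<in> F"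
    and maps: "\<And>i y. i \<in> I \<Longrightarrow> y \<in> Y \<Longrightarrow> b i + a i * y \<in> U"
    and K: "2 \<le> K" and sizes: "M / K \<le> real (card I)" "real (card I) \<le> K * M" "M / K \<le> real (card Y)"
    and bad: "\<And>i. i \<in> I \<Longrightarrow> real (card {j \<in> I. bad i j}) \<le> K"
    and mult: "\<And>m c. m \<in> F \<Longrightarrow> c \<in> F \<Longrightarrow>
       real (card {(i, j) \<in> I \<times> I. \<not> bad i j \<and> a j = m * a i \<and> b j = m * b i + c}) \<le> K"
    and large: "K ^ 3 \<le> M"
  shows "\<exists>T\<subseteq>F - {0}. M / K ^ 8 \<le> real (card T) \<and>
    (\<forall>s\<in>T. \<exists>G\<subseteq>U \<times> U. M\<^sup>2 / K ^ 10 \<le> real (card G) \<and> real (card ((\<lambda>(v, w). v + s * w) ` G)) \<le> M)"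
proof -
  have K0: "0 < K" and K1: "1 \<le> K" using K by auto
  have M0: "0 < M" using large K0 zero_less_power[OF K0, of 3] by linarith
  have fU: "finite U" using U finF finite_subset by blast
  have fY: "finite Y" using Y finF finite_subset by blast
  define Z where "Z = (\<lambda>i. (\<lambda>y. b i + a i * y) ` Y)"
  have Z: "Z i \<subseteq> U" "finite (Z i)" "card (Z i) = card Y" if i: "i \<in> I" for i
  proof -
    show "Z i \<subseteq> U" using maps i by (auto simp: Z_def)
    show "finite (Z i)" using fY by (simp add: Z_def)
    show "card (Z i) = card Y"
      unfolding Z_def using ab[OF i] Y by (intro card_image inj_onI) (auto simp: mult_left_cancel subset_iff)
  qed
  let ?n = "real (card Y)"
  have "K\<^sup>2 \<le> M / K" using large K0 by (simp add: field_simps power2_eq_square power3_eq_cube)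
  moreover have "(2 :: real)\<^sup>2 \<le> K\<^sup>2" using K by (intro power_mono) auto
  ultimately have n4: "4 \<le> ?n" "K\<^sup>2 \<le> M / K" using sizes by simp_all
  define Pr where "Pr = {q \<in> U \<times> U. fst q \<noteq> snd q}"
  define Tr where "Tr = (SIGMA q:Pr. U - {fst q, snd q})"
  define In where "In = (\<lambda>t i. fst (fst t) \<in> Z i \<and> snd (fst t) \<in> Z i \<and> snd t \<in> Z i)"
  have fPr: "finite Pr" and fTr: "finite Tr" using fU by (auto simp: Pr_def Tr_def)
  define c where "c = (\<lambda>t. real (card {i \<in> I. In t i}))"
  have "real (card I) * (?n ^ 3 / 4) \<le> (\<Sum>i\<in>I. real (card {t \<in> Tr. In t i}))"
  proof (rule sum_bounded_below)
    fix i assume i: "i \<in> I"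
    have "{t \<in> Tr. In t i} = (SIGMA q:(SIGMA u:Z i. Z i - {u}). Z i - {fst q, snd q})"
      using Z(1)[OF i] by (auto simp: Tr_def Pr_def In_def)
    also have "card \<dots> = (\<Sum>q\<in>(SIGMA u:Z i. Z i - {u}). card (Z i - {fst q, snd q}))"
      using Z(2)[OF i] by (intro card_SigmaI) auto
    also have "\<dots> = (\<Sum>q\<in>(SIGMA u:Z i. Z i - {u}). card Y - 2)"
    proof (rule sum.cong)
      fix q assume "q \<in> (SIGMA u:Z i. Z i - {u})"
      hence "{fst q, snd q} \<subseteq> Z i" "card {fst q, snd q} = 2" by (auto simp: card_insert_if)
      thus "card (Z i - {fst q, snd q}) = card Y - 2"
        using Z[OF i] by (subst card_Diff_subset) auto
    qed simp
    also have "\<dots> = card (SIGMA u:Z i. Z i - {u}) * (card Y - 2)" by simp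
    also have "card (SIGMA u:Z i. Z i - {u}) = card Y * (card Y - 1)"
      using Z[OF i] by (subst card_SigmaI) auto
    finally have "real (card {t \<in> Tr. In t i}) = ?n * (?n - 1) * (?n - 2)"
      using n4 by (simp add: of_nat_diff)
    moreover have "?n * (?n / 2) * (?n / 2) \<le> ?n * (?n - 1) * (?n - 2)"
      using n4 by (intro mult_mono) auto
    ultimately show "?n ^ 3 / 4 \<le> real (card {t \<in> Tr. In t i})" by (simp add: power3_eq_cube)
  qed
  also have "\<dots> = (\<Sum>t\<in>Tr. c t)" unfolding c_def by (rule double_count[OF I fTr])
  also have "\<dots> = (\<Sum>q\<in>Pr. \<Sum>w\<in>U - {fst q, snd q}. c (q, w))"
    unfolding Tr_def using fPr fU by (subst sum.Sigma) auto
  finally have "real (card I) * (?n ^ 3 / 4) \<le> (\<Sum>q\<in>Pr. \<Sum>w\<in>U - {fst q, snd q}. c (q, w))" .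
  moreover have "M ^ 4 / K ^ 6 \<le> real (card I) * (?n ^ 3 / 4)"
  proof -
    have "2 * 2 \<le> K * K" using K by (intro mult_mono) auto
    hence "M ^ 4 / (K * K * K ^ 4) \<le> M ^ 4 / (4 * K ^ 4)"
      using K0 M0 by (intro divide_left_mono mult_right_mono) auto
    also have "\<dots> = (M / K) * ((M / K) ^ 3 / 4)" by (simp add: power_divide eval_nat_numeral)
    also have "\<dots> \<le> real (card I) * (?n ^ 3 / 4)"
      using sizes K0 M0 by (intro mult_mono divide_right_mono power_mono) auto
    finally show ?thesis by (simp add: eval_nat_numeral mult_ac)
  qed
  ultimately have "M ^ 4 / K ^ 6 \<le> (\<Sum>q\<in>Pr. \<Sum>w\<in>U - {fst q, snd q}. c (q, w))" by linarith
  moreover have "real (card Pr) \<le> M\<^sup>2"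
  proof -
    have "card Pr \<le> card (U \<times> U)" using fU by (intro card_mono) (auto simp: Pr_def)
    thus ?thesis by (simp add: M_def card_cartesian_product power2_eq_square flip: of_nat_mult)
  qed
  moreover have "0 < M ^ 4 / K ^ 6" using M0 K0 by simp
  ultimately have "\<exists>q\<in>Pr. M ^ 4 / K ^ 6 / M\<^sup>2 \<le> (\<Sum>w\<in>U - {fst q, snd q}. c (q, w))"
    by (intro exists_ge_average[OF fPr])
  then obtain q where q: "q \<in> Pr" "M ^ 4 / K ^ 6 / M\<^sup>2 \<le> (\<Sum>w\<in>U - {fst q, snd q}. c (q, w))"
    by blast
  obtain u u' where uu: "q = (u, u')" by (cases q)
  have u: "u \<in> U" "u' \<in> U" "u \<noteq> u'" using q uu by (auto simp: Pr_def)
  hence uF: "u \<in> F" "u' \<in> F" using U by auto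
  define T0 where "T0 = {w \<in> U - {u, u'}. M / (2 * K ^ 6) \<le> c ((u, u'), w)}"
  have fT0: "finite T0" using fU by (simp add: T0_def)
  have "M\<^sup>2 / K ^ 6 = M ^ 4 / K ^ 6 / M\<^sup>2" using M0 by (simp add: eval_nat_numeral)
  also have "\<dots> \<le> (\<Sum>w\<in>U - {u, u'}. c ((u, u'), w))" using q uu by simp
  also have "\<dots> \<le> (\<Sum>w\<in>U - {u, u'}. (if w \<in> T0 then K * M else 0) + M / (2 * K ^ 6))"
  proof (rule sum_mono)
    fix w assume w: "w \<in> U - {u, u'}"
    have "c ((u, u'), w) \<le> real (card I)" using I by (simp add: c_def card_mono)
    hence "c ((u, u'), w) \<le> K * M" using sizes by linarith
    thus "c ((u, u'), w) \<le> (if w \<in> T0 then K * M else 0) + M / (2 * K ^ 6)"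
      using w M0 K0 by (auto simp: T0_def intro: add_increasing2)
  qed
  also have "\<dots> = real (card T0) * (K * M) + real (card (U - {u, u'})) * (M / (2 * K ^ 6))"
    using fU by (simp add: sum.distrib T0_def flip: sum.inter_filter)
  also have "\<dots> \<le> real (card T0) * (K * M) + M * (M / (2 * K ^ 6))"
    using fU M0 K0 by (intro add_left_mono mult_right_mono) (auto simp: M_def card_mono)
  finally have "(K * M) * (M / (2 * K ^ 7)) \<le> (K * M) * real (card T0)"
    using K0 by (simp add: field_simps eval_nat_numeral)
  hence "M / (2 * K ^ 7) \<le> real (card T0)" using K0 M0 by (subst (asm) mult_le_cancel_left_pos) auto
  moreover have "M / K ^ 8 \<le> M / (2 * K ^ 7)"
  proof -
    have "2 * K ^ 7 \<le> K * K ^ 7" using K by (intro mult_right_mono) auto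
    hence "M / (K * K ^ 7) \<le> M / (2 * K ^ 7)" using M0 K0 by (intro divide_left_mono) auto
    thus ?thesis by (simp add: eval_nat_numeral)
  qed
  ultimately have cT0: "M / K ^ 8 \<le> real (card T0)" by linarith
  \<comment> \<open>the solution \<open>s\<close> of \<open>u + s u' = w + s w\<close>\<close>
  define \<sigma> where "\<sigma> = (\<lambda>w. (w - u) * recip (u' - w))"
  have \<sigma>: "\<sigma> w \<in> F" "\<sigma> w \<noteq> 0" "\<sigma> w * (u' - w) = w - u" if w: "w \<in> T0" for w
  proof -
    have wF: "w \<in> F" "w - u \<in> F" "u' - w \<in> F" "u' - w \<noteq> 0" "w \<noteq> u"
      using w U uF diff_in by (auto simp: T0_def)
    show "\<sigma> w \<in> F" using wF by (auto simp: \<sigma>_def intro!: mult_in recip)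
    have "\<sigma> w * (u' - w) = (w - u) * ((u' - w) * recip (u' - w))" by (simp only: \<sigma>_def mult_ac)
    also have "\<dots> = w - u" using wF by (simp add: recip mult_e)
    finally show "\<sigma> w * (u' - w) = w - u" .
    thus "\<sigma> w \<noteq> 0" using wF by auto
  qed
  have "inj_on \<sigma> T0"
  proof (rule inj_onI)
    fix w1 w2 assume w: "w1 \<in> T0" "w2 \<in> T0" "\<sigma> w1 = \<sigma> w2"
    define s where "s = \<sigma> w1"
    have s: "s \<in> F" "s * (u' - w1) = w1 - u" "s * (u' - w2) = w2 - u"
      using \<sigma>[OF w(1)] \<sigma>[OF w(2)] w(3) by (simp_all add: s_def)
    have wF: "w1 \<in> F" "w2 \<in> F" using w U by (auto simp: T0_def)
    have "s * (w1 - w2) = s * (u' - w2) - s * (u' - w1)" by (simp add: algebra_simps)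
    also have "\<dots> = - (w1 - w2)" using s by simp
    finally have eq: "s * (w1 - w2) = - (w1 - w2)" .
    show "w1 = w2"
    proof (rule ccontr)
      assume "w1 \<noteq> w2"
      hence d: "w1 - w2 \<in> F" "w1 - w2 \<noteq> 0" using wF diff_in by auto
      have "s = - (w1 - w2) * recip (w1 - w2)"
        by (rule slope_unique[OF d s(1) uminus_in[OF d(1)] eq])
      also have "\<dots> = - ((w1 - w2) * recip (w1 - w2))" by (rule mult_minus_left)
      also have "\<dots> = - e" using recip(2)[OF d] by (rule arg_cong)
      finally have "s * (u' - w1) = - (e * (u' - w1))" by (simp only: mult_minus_left)
      hence "- (u' - w1) = w1 - u" using s(2) e_mult[OF diff_in[OF uF(2) wF(1)]] by (simp only:)
      thus False using u by simp
    qed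
  qed
  hence cT: "M / K ^ 8 \<le> real (card (\<sigma> ` T0))" using cT0 by (simp add: card_image)
  have "\<exists>G\<subseteq>U \<times> U. M\<^sup>2 / K ^ 10 \<le> real (card G) \<and> real (card ((\<lambda>(v, v'). v + \<sigma> w * v') ` G)) \<le> M"
    if w: "w \<in> T0" for w
  proof -
    define s where "s = \<sigma> w"
    have s: "s * (u' - w) = w - u" using \<sigma>[OF w] by (simp add: s_def)
    have "u + s * u' = u + s * (u' - w) + s * w" by (simp add: algebra_simps)
    also have "\<dots> = w + s * w" by (simp add: s)
    finally have suw: "u + s * u' = w + s * w" .
    define C where "C = {i \<in> I. u \<in> Z i \<and> u' \<in> Z i \<and> w \<in> Z i}"
    have fC: "finite C" using I by (simp add: C_def)
    have "M / (2 * K ^ 6) \<le> real (card C)" using w by (simp add: T0_def c_def C_def In_def)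
    moreover have "M / (K * K ^ 6) \<le> M / (2 * K ^ 6)"
      using K K0 M0 by (intro divide_left_mono mult_right_mono) auto
    ultimately have cC: "M / K ^ 7 \<le> real (card C)" by (simp add: eval_nat_numeral)
    define E where "E = (SIGMA i:C. {j \<in> I. \<not> bad i j})"
    have fE: "finite E" using I fC by (auto simp: E_def)
    have "M / K ^ 9 * M = (M / K ^ 7) * (M / K\<^sup>2)" by (simp add: eval_nat_numeral)
    also have "\<dots> \<le> real (card C) * (M / K\<^sup>2)" using cC M0 K0 by (intro mult_right_mono) auto
    also have "\<dots> \<le> (\<Sum>i\<in>C. real (card {j \<in> I. \<not> bad i j}))"
    proof (rule sum_bounded_below)
      fix i assume "i \<in> C"
      hence i: "i \<in> I" by (simp add: C_def)
      have "{j \<in> I. \<not> bad i j} = I - {j \<in> I. bad i j}" by auto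
      moreover have "card {j \<in> I. bad i j} \<le> card I" using I by (intro card_mono) auto
      ultimately have "real (card {j \<in> I. \<not> bad i j}) = real (card I) - real (card {j \<in> I. bad i j})"
        using I by (simp add: card_Diff_subset of_nat_diff)
      hence "M / K - K \<le> real (card {j \<in> I. \<not> bad i j})" using sizes bad[OF i] by linarith
      moreover have "M / K\<^sup>2 \<le> M / K - K"
      proof -
        have "2 * (M / K\<^sup>2) \<le> K * (M / K\<^sup>2)" using K M0 by (intro mult_right_mono) auto
        also have "\<dots> = M / K" using K0 by (simp add: power2_eq_square)
        finally have h1: "2 * (M / K\<^sup>2) \<le> M / K" .
        have "2 * K \<le> K * K" using K by (intro mult_right_mono) auto
        also have "\<dots> \<le> M / K" using n4(2) by (simp add: power2_eq_square)
        finally show ?thesis using h1 by linarith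
      qed
      ultimately show "M / K\<^sup>2 \<le> real (card {j \<in> I. \<not> bad i j})" by linarith
    qed
    also have "\<dots> = real (card E)" unfolding E_def using I fC by (subst card_SigmaI) auto
    finally have cE: "M\<^sup>2 / K ^ 9 \<le> real (card E)" by (simp add: power2_eq_square)
    \<comment> \<open>the composite of the map with index \<open>j\<close> and the inverse of the map with index \<open>i\<close>\<close>
    define \<psi> where "\<psi> = (\<lambda>(i, j) x. a j * recip (a i) * (x - b i) + b j)"
    have \<psi>_in: "\<psi> ij x \<in> U" if ijx: "ij \<in> E" "x \<in> Z (fst ij)" for ij x
    proof -
      obtain i j where ij: "ij = (i, j)" by (cases ij)
      have iI: "i \<in> I" "j \<in> I" using ijx(1) ij by (auto simp: E_def C_def)
      obtain y where y: "y \<in> Y" "x = b i + a i * y" using ijx(2) ij by (auto simp: Z_def)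
      have "\<psi> ij x = a j * (recip (a i) * (a i * y)) + b j" by (simp add: \<psi>_def ij y mult.assoc)
      also have "\<dots> = b j + a j * y"
        using recip_mult_cancel[of "a i" y] ab[OF iI(1)] y Y by auto
      also have "\<dots> \<in> U" using maps iI y by blast
      finally show ?thesis .
    qed
    have EZ: "u \<in> Z (fst ij)" "u' \<in> Z (fst ij)" "w \<in> Z (fst ij)" if "ij \<in> E" for ij
      using that by (auto simp: E_def C_def)
    define G where "G = (\<lambda>ij. (\<psi> ij u, \<psi> ij u')) ` E"
    have GU: "G \<subseteq> U \<times> U" using \<psi>_in EZ by (auto simp: G_def)
    have fG: "finite G" using fE by (simp add: G_def)
    have "real (card E) \<le> (\<Sum>g\<in>G. real (card {ij \<in> E. (\<psi> ij u, \<psi> ij u') = g}))"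
    proof -
      have "E = (\<Union>g\<in>G. {ij \<in> E. (\<psi> ij u, \<psi> ij u') = g})" by (auto simp: G_def)
      hence "card E \<le> (\<Sum>g\<in>G. card {ij \<in> E. (\<psi> ij u, \<psi> ij u') = g})"
        using card_UN_le[OF fG, of "\<lambda>g. {ij \<in> E. (\<psi> ij u, \<psi> ij u') = g}"] by simp
      thus ?thesis by (simp flip: of_nat_sum)
    qed
    also have "\<dots> \<le> (\<Sum>g\<in>G. K)"
    proof (rule sum_mono)
      fix g assume "g \<in> G"
      then obtain v v' where g: "g = (v, v')" "v \<in> F" "v' \<in> F" using GU U by (cases g) auto
      define m where "m = (v - v') * recip (u - u')"
      have uuF: "u - u' \<in> F" "u - u' \<noteq> 0" using uF u diff_in by auto
      have mF: "m \<in> F" using g uuF by (auto simp: m_def intro!: mult_in diff_in recip)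
      have "{ij \<in> E. (\<psi> ij u, \<psi> ij u') = g}
          \<subseteq> {(i, j) \<in> I \<times> I. \<not> bad i j \<and> a j = m * a i \<and> b j = m * b i + (v - m * u)}"
      proof
        fix q assume "q \<in> {ij \<in> E. (\<psi> ij u, \<psi> ij u') = g}"
        then obtain i j where q: "q = (i, j)" and ijE: "(i, j) \<in> E" and eq: "g = (\<psi> (i, j) u, \<psi> (i, j) u')"
          by (cases q) auto
        have ij: "i \<in> I" "j \<in> I" "\<not> bad i j" using ijE by (auto simp: E_def C_def)
        define r where "r = a j * recip (a i)"
        have rF: "r \<in> F" using ab[OF ij(1)] ab[OF ij(2)] by (auto simp: r_def intro!: mult_in recip)
        have v: "v = r * (u - b i) + b j" "v' = r * (u' - b i) + b j"
          using eq g by (auto simp: \<psi>_def r_def)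
        have "r * (u - u') = v - v'" by (simp add: v algebra_simps)
        hence rm: "r = m" unfolding m_def using uuF rF g diff_in by (intro slope_unique) auto
        have "m * a i = a j * (a i * recip (a i))" unfolding rm[symmetric] r_def by (simp only: mult_ac)
        hence "a j = m * a i" using ab[OF ij(1)] ab[OF ij(2)] by (simp add: recip mult_e)
        moreover have "b j = m * b i + (v - m * u)" using v rm by (simp add: algebra_simps)
        ultimately show "q \<in> {(i, j) \<in> I \<times> I. \<not> bad i j \<and> a j = m * a i \<and> b j = m * b i + (v - m * u)}"
          using ij q by simp
      qed
      hence "card {ij \<in> E. (\<psi> ij u, \<psi> ij u') = g}
          \<le> card {(i, j) \<in> I \<times> I. \<not> bad i j \<and> a j = m * a i \<and> b j = m * b i + (v - m * u)}"
        using I by (intro card_mono) (auto intro: finite_subset[of _ "I \<times> I"])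
      moreover have "v - m * u \<in> F" using g mF uF by (intro diff_in mult_in)
      ultimately show "real (card {ij \<in> E. (\<psi> ij u, \<psi> ij u') = g}) \<le> K"
        using mult[OF mF] by (meson of_nat_mono order_trans)
    qed
    also have "\<dots> = K * real (card G)" by simp
    finally have "M\<^sup>2 / K ^ 9 \<le> K * real (card G)" using cE by linarith
    hence "M\<^sup>2 / K ^ 10 \<le> real (card G)" using K0 by (simp add: field_simps eval_nat_numeral)
    moreover have "(\<lambda>(v, v'). v + s * v') ` G \<subseteq> (\<lambda>x. x + s * x) ` U"
    proof (unfold G_def, clarify)
      fix i j assume ij: "(i, j) \<in> E"
      define r where "r = a j * recip (a i)"
      have "\<psi> (i, j) u + s * \<psi> (i, j) u' = r * (u + s * u') + (b j - r * b i) + s * (b j - r * b i)"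
        by (simp add: \<psi>_def r_def algebra_simps)
      also have "\<dots> = \<psi> (i, j) w + s * \<psi> (i, j) w"
        unfolding suw by (simp add: \<psi>_def r_def algebra_simps)
      finally show "\<psi> (i, j) u + s * \<psi> (i, j) u' \<in> (\<lambda>x. x + s * x) ` U"
        using \<psi>_in[OF ij EZ(3)[OF ij]] by blast
    qed
    hence "card ((\<lambda>(v, v'). v + s * v') ` G) \<le> card ((\<lambda>x. x + s * x) ` U)"
      using fU by (intro card_mono) auto
    hence "real (card ((\<lambda>(v, v'). v + s * v') ` G)) \<le> M"
      using card_image_le[OF fU, of "\<lambda>x. x + s * x"] unfolding M_def by linarith
    ultimately show ?thesis using GU by (auto simp: s_def)
  qed
  thus ?thesis using \<sigma> cT by (intro exI[of _ "\<sigma> ` T0"]) auto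
qed

text \<open>
  No set of size \<open>M\<close> contains the images of a set of comparable size under about \<open>M\<close> affine maps with
  mostly distinct quotients, unless \<open>M\<close> is bounded or comparable to the size of the field. If
  \<open>M < K\<^sup>3\<close> the bound is trivial; otherwise the graphs of \<open>rich_ratios\<close> are dense enough for
  \<open>dense_dilate_graphs\<close> with \<open>K\<^bsup>10\<^esup>\<close> in place of \<open>K\<close>.
\<close>

lemma affine_family_growth:
  fixes U Y :: "'a set" and I :: "'i set" and a b :: "'i \<Rightarrow> 'a" and bad :: "'i \<Rightarrow> 'i \<Rightarrow> bool" and K :: real
  defines "M \<equiv> real (card U)"
  assumes U: "U \<subseteq> F" and Y: "Y \<subseteq> F" and I: "finite I"
    and ab: "\<And>i. i \<in> I \<Longrightarrow> a i \<in> F - {0}" "\<And>i. i \<in> I \<Longrightarrow> b i \<in> F"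
    and maps: "\<And>i y. i \<in> I \<Longrightarrow> y \<in> Y \<Longrightarrow> b i + a i * y \<in> U"
    and K: "2 \<le> K" and sizes: "M / K \<le> real (card I)" "real (card I) \<le> K * M" "M / K \<le> real (card Y)"
    and bad: "\<And>i. i \<in> I \<Longrightarrow> real (card {j \<in> I. bad i j}) \<le> K"
    and mult: "\<And>m c. m \<in> F \<Longrightarrow> c \<in> F \<Longrightarrow>
       real (card {(i, j) \<in> I \<times> I. \<not> bad i j \<and> a j = m * a i \<and> b j = m * b i + c}) \<le> K"
  shows "M \<le> K ^ 700000 \<or> real (card F) \<le> K ^ 700000 * M"
proof (cases "K ^ 3 \<le> M")
  case False
  have "K ^ 3 \<le> K ^ 700000" using K by (intro power_increasing) auto
  thus ?thesis using False by linarith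
next
  case True
  have M0: "0 < M" using True K zero_less_power[of K 3] by linarith
  obtain T where T: "T \<subseteq> F - {0}" "M / K ^ 8 \<le> real (card T)" and
    G: "\<And>s. s \<in> T \<Longrightarrow> \<exists>G\<subseteq>U \<times> U. M\<^sup>2 / K ^ 10 \<le> real (card G) \<and> real (card ((\<lambda>(v, w). v + s * w) ` G)) \<le> M"
    using rich_ratios[OF U Y I ab maps K sizes[unfolded M_def] bad mult True[unfolded M_def], folded M_def]
    by blast
  have "M \<le> (K ^ 10) ^ 70000 \<or> real (card F) \<le> (K ^ 10) ^ 70000 * M"
  proof (rule dense_dilate_graphs[OF U _ M0 _ T(1) _ G])
    have "K ^ 1 \<le> K ^ 10" using K by (intro power_increasing) auto
    thus "2 \<le> K ^ 10" using K by simp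
    have "M / K ^ 10 \<le> M / K ^ 8" using K M0 by (intro divide_left_mono power_increasing) auto
    thus "M / K ^ 10 \<le> real (card T)" using T by linarith
  qed (auto simp: M_def)
  moreover have "(K ^ 10) ^ 70000 = K ^ 700000" using power_mult[of K 10 70000] by simp
  ultimately show ?thesis by (simp only:)
qed

end

section \<open>The integers modulo a prime\<close>

text \<open>
  A single type that contains every ring of integers modulo \<open>n\<close>: their product over all \<open>n\<close>, the
  factor at \<open>0\<close> being the integers themselves because \<open>x mod 0 = x\<close>. Hence results about fields inside
  a commutative ring type apply to every prime \<open>p\<close>, with \<open>p\<close> an ordinary variable.
\<close>

typedef zmod_product = "{f :: nat \<Rightarrow> int. \<forall>n. f n mod int n = f n}"
  by (rule exI[of _ "\<lambda>_. 0"]) simp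

setup_lifting type_definition_zmod_product

instantiation zmod_product :: comm_ring
begin

lift_definition zero_zmod_product :: zmod_product is "\<lambda>_. 0" by simp
lift_definition plus_zmod_product :: "zmod_product \<Rightarrow> zmod_product \<Rightarrow> zmod_product"
  is "\<lambda>f g n. (f n + g n) mod int n" by simp
lift_definition minus_zmod_product :: "zmod_product \<Rightarrow> zmod_product \<Rightarrow> zmod_product"
  is "\<lambda>f g n. (f n - g n) mod int n" by simp
lift_definition uminus_zmod_product :: "zmod_product \<Rightarrow> zmod_product"
  is "\<lambda>f n. (- f n) mod int n" by simp
lift_definition times_zmod_product :: "zmod_product \<Rightarrow> zmod_product \<Rightarrow> zmod_product"
  is "\<lambda>f g n. (f n * g n) mod int n" by simp

instance
proof
  fix x y z :: zmod_product
  show "x + y + z = x + (y + z)" by transfer (simp add: mod_simps add.assoc)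
  show "x + y = y + x" by transfer (simp add: add.commute)
  show "0 + x = x" by transfer simp
  show "- x + x = 0" by transfer (simp add: mod_simps)
  show "x - y = x + - y" by transfer (simp add: mod_simps)
  show "x * y * z = x * (y * z)" by transfer (simp add: mod_simps mult.assoc)
  show "x * y = y * x" by transfer (simp add: mult.commute)
  show "(x + y) * z = x * z + y * z" by transfer (simp add: mod_simps distrib_right)
qed

end

lift_definition residue :: "nat \<Rightarrow> int \<Rightarrow> zmod_product"
  is "\<lambda>p x n. if n = p then x mod int p else 0" by auto

lemma residue_eq_iff: "residue p x = residue p y \<longleftrightarrow> [x = y] (mod int p)"
  by transfer (auto simp: cong_def fun_eq_iff)

lemma residue_add: "residue p (x + y) = residue p x + residue p y"
  by transfer (auto simp: mod_simps)

lemma residue_mult: "residue p (x * y) = residue p x * residue p y"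
  by transfer (auto simp: mod_simps)

lemma residue_uminus: "residue p (- x) = - residue p x"
  by transfer (auto simp: mod_simps)

lemma residue_0: "residue p 0 = 0" by transfer auto

lemma residue_eq_0_iff: "residue p x = 0 \<longleftrightarrow> int p dvd x"
  using residue_eq_iff[of p x 0] by (simp add: residue_0 cong_0_iff)

lemma residue_mod: "residue p (x mod int p) = residue p x"
  by (simp add: residue_eq_iff cong_def)

lemma range_residue:
  assumes "0 < p"
  shows "range (residue p) = residue p ` {0..<int p}"
proof -
  have "residue p x \<in> residue p ` {0..<int p}" for x
    using assms by (intro image_eqI[of _ _ "x mod int p"]) (auto simp: residue_mod)
  thus ?thesis by blast
qed

lemma card_range_residue: "0 < p \<Longrightarrow> card (range (residue p)) = p"
  by (simp add: range_residue card_image inj_on_def residue_eq_iff cong_def)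

lemma prime_field_residue:
  assumes "prime p"
  shows "prime_field_in_ring (range (residue p)) (residue p 1)"
proof
  have p: "1 < p" using assms by (rule prime_gt_1_nat)
  show "finite (range (residue p))" using p by (simp add: range_residue)
  show "residue p 1 \<noteq> 0" using p by (simp add: residue_eq_0_iff)
  fix x y assume xy: "x \<in> range (residue p)" "y \<in> range (residue p)"
  then obtain i j where ij: "x = residue p i" "y = residue p j" by blast
  show "x + y \<in> range (residue p)" "x * y \<in> range (residue p)" "- x \<in> range (residue p)"
    by (auto simp: ij simp flip: residue_add residue_mult residue_uminus)
  show "residue p 1 * x = x" by (simp add: ij flip: residue_mult)
next
  fix x assume "x \<in> range (residue p)" "x \<noteq> 0"
  then obtain i where i: "x = residue p i" "\<not> int p dvd i"
    by (auto simp: residue_eq_0_iff)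
  hence "coprime (int p) i" using assms by (intro prime_imp_coprime) auto
  hence "coprime i (int p)" by (simp add: coprime_commute)
  then obtain j where "[i * j = 1] (mod int p)" using cong_solve_coprime_int by blast
  hence "x * residue p j = residue p 1" by (simp add: i residue_eq_iff flip: residue_mult)
  thus "\<exists>y\<in>range (residue p). x * y = residue p 1" by blast
next
  fix G assume G: "0 \<in> G" "\<And>x. x \<in> G \<Longrightarrow> x + residue p 1 \<in> G"
  have "residue p (int n) \<in> G" for n
  proof (induction n)
    case (Suc n)
    thus ?case using G(2)[of "residue p (int n)"] by (simp add: add.commute flip: residue_add)
  qed (simp add: residue_0 G)
  thus "range (residue p) \<subseteq> G"
    using assms prime_gt_0_nat[of p] unfolding range_residue[OF prime_gt_0_nat[OF assms]]
    by (metis atLeastLessThan_iff image_subsetI nat_0_le)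
qed simp

section \<open>Polynomial congruences modulo a prime\<close>

lemma finite_residues [simp]: "finite {x :: int. 0 \<le> x \<and> x < int p \<and> P x}"
  by (rule finite_subset[of _ "{0..<int p}"]) auto

lemma card_roots_mod_prime_le:
  fixes h :: "int poly"
  assumes p: "prime p" and i: "\<not> int p dvd coeff h i"
  shows "card {x \<in> {0..<int p}. int p dvd poly h x} \<le> degree h"
  using i
proof (induction "degree h" arbitrary: h i)
  case 0
  then obtain c where h: "h = [:c:]" by (metis degree_eq_zeroE)
  have "\<not> int p dvd c" using 0 by (cases i) (auto simp: h)
  thus ?case by (simp add: h)
next
  case (Suc n h i)
  show ?case
  proof (cases "{x \<in> {0..<int p}. int p dvd poly h x} = {}")
    case False
    then obtain r where r: "r \<in> {0..<int p}" "int p dvd poly h r" by blast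
    define q where "q = synthetic_div h r"
    have h: "h = [:- r, 1:] * q + [:poly h r:]"
      unfolding q_def by (rule synthetic_div_correct'[symmetric])
    have dq: "n = degree q" using Suc(2) by (simp add: q_def degree_synthetic_div)
    have "\<not> [:int p:] dvd q"
    proof
      assume "[:int p:] dvd q"
      moreover have "[:int p:] dvd [:poly h r:]" using r by (simp add: const_poly_dvd_const_poly_iff)
      ultimately have "[:int p:] dvd [:- r, 1:] * q + [:poly h r:]" by (intro dvd_add dvd_mult)
      hence "[:int p:] dvd h" by (simp only: h[symmetric])
      thus False using Suc(3) by (simp add: const_poly_dvd_iff)
    qed
    then obtain i' where i': "\<not> int p dvd coeff q i'" by (auto simp: const_poly_dvd_iff)
    have "{x \<in> {0..<int p}. int p dvd poly h x} \<subseteq> insert r {x \<in> {0..<int p}. int p dvd poly q x}"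
    proof
      fix x assume "x \<in> {x \<in> {0..<int p}. int p dvd poly h x}"
      hence x: "x \<in> {0..<int p}" "int p dvd poly h x" by auto
      have "poly h x = poly ([:- r, 1:] * q + [:poly h r:]) x" using h by (rule arg_cong)
      also have "\<dots> = (x - r) * poly q x + poly h r" by (simp add: left_diff_distrib)
      finally have "int p dvd (x - r) * poly q x"
        using x(2) r(2) dvd_add_left_iff[of "int p" "poly h r" "(x - r) * poly q x"] by simp
      hence "int p dvd x - r \<or> int p dvd poly q x" using p by (simp add: prime_dvd_mult_iff)
      moreover have "x = r" if "int p dvd x - r"
      proof -
        have "[x = r] (mod int p)" using that by (simp add: cong_iff_dvd_diff)
        thus "x = r" using x r by (simp add: cong_def)
      qed
      ultimately show "x \<in> insert r {x \<in> {0..<int p}. int p dvd poly q x}" using x(1) by auto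
    qed
    hence "card {x \<in> {0..<int p}. int p dvd poly h x}
             \<le> card (insert r {x \<in> {0..<int p}. int p dvd poly q x})"
      by (intro card_mono) auto
    also have "\<dots> \<le> Suc (card {x \<in> {0..<int p}. int p dvd poly q x})"
      by (rule card_insert_le_m1) auto
    also have "\<dots> \<le> Suc n" using Suc(1)[OF dq i'] dq by simp
    finally show ?thesis using Suc(2) by simp
  next
    case True
    show ?thesis unfolding True by simp
  qed
qed


lemma card_le_fibres:
  fixes d :: nat
  assumes "finite A" "\<And>u. u \<in> h ` A \<Longrightarrow> card {x \<in> A. h x = u} \<le> d"
  shows "card A \<le> d * card (h ` A)"
proof -
  have "A = (\<Union>u\<in>h ` A. {x \<in> A. h x = u})" by auto
  hence "card A \<le> (\<Sum>u\<in>h ` A. card {x \<in> A. h x = u})"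
    using card_UN_le[of "h ` A" "\<lambda>u. {x \<in> A. h x = u}"] assms(1) by simp
  also have "\<dots> \<le> (\<Sum>u\<in>h ` A. d)" by (rule sum_mono) (rule assms(2))
  finally show ?thesis by (simp add: mult.commute)
qed

lemma card_poly_fibres_mod_prime_le:
  fixes h :: "int poly"
  assumes p: "prime p" and i: "0 < i" "\<not> int p dvd coeff h i" and A: "A \<subseteq> {0..<int p}"
  shows "card {x \<in> A. [poly h x = c] (mod int p)} \<le> degree h"
proof -
  have "coeff (h - [:c:]) i = coeff h i" using i by (cases i) auto
  hence "card {x \<in> {0..<int p}. int p dvd poly (h - [:c:]) x} \<le> degree (h - [:c:])"
    using card_roots_mod_prime_le[OF p, of "h - [:c:]" i] i by simp
  moreover have "degree (h - [:c:]) \<le> degree h" by (rule degree_diff_le) auto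
  moreover have "card {x \<in> A. [poly h x = c] (mod int p)} \<le> card {x \<in> {0..<int p}. int p dvd poly (h - [:c:]) x}"
  proof (rule card_mono)
    show "{x \<in> A. [poly h x = c] (mod int p)} \<subseteq> {x \<in> {0..<int p}. int p dvd poly (h - [:c:]) x}"
      using A by (auto simp: cong_iff_dvd_diff)
  qed (rule finite_subset[of _ "{0..<int p}"], auto)
  ultimately show ?thesis by linarith
qed

text \<open>
  The lines \<open>y \<mapsto> f(x) + x\<^sup>k y\<close> at \<open>x\<close> and \<open>x'\<close> differ by the affine map with data \<open>(\<mu>, \<gamma>)\<close>. With
  \<open>x' = \<omega> x\<close> one has \<open>\<omega>\<^sup>k = \<mu>\<close>, so there are at most \<open>k\<close> values of \<open>\<omega>\<close>, and \<open>x\<close> is a root of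
  \<open>f(\<omega> x) - \<mu> f(x) - \<gamma>\<close>. The coefficient of this polynomial at \<open>j\<close> is \<open>coeff f j * (\<omega>\<^sup>j - \<omega>\<^sup>k)\<close>, which
  vanishes only if \<open>\<omega>\<^sup>l = 1\<close> for \<open>l = |j - k|\<close>; these pairs are excluded. Here a monomial of \<open>f\<close> other than
  \<open>1\<close> and \<open>x\<^sup>k\<close> is indispensable.
\<close>

lemma card_coincident_lines_le:
  fixes f :: "int poly" and k j l p :: nat
  assumes p: "prime p" and k: "0 < k" and j: "0 < j" "\<not> int p dvd coeff f j"
    and l: "j = k + l \<or> k = j + l" and I: "I \<subseteq> {1..<int p}"
  shows "card {(x, x') \<in> I \<times> I. \<not> [x' ^ l = x ^ l] (mod int p) \<and> [x' ^ k = \<mu> * x ^ k] (mod int p) \<and>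
            [poly f x' = \<mu> * poly f x + \<gamma>] (mod int p)} \<le> k * degree f" (is "card ?P \<le> _")
proof -
  define \<Omega> where "\<Omega> = {\<omega> \<in> {0..<int p}. [\<omega> ^ k = \<mu>] (mod int p) \<and> \<not> [\<omega> ^ l = 1] (mod int p) \<and> \<not> int p dvd \<omega>}"
  define h where "h = (\<lambda>\<omega>. pcompose f [:0, \<omega>:] - smult \<mu> f)"
  define R where "R = (\<lambda>\<omega>. {x \<in> {0..<int p}. [poly (h \<omega>) x = \<gamma>] (mod int p)})"
  have prime_p: "prime (int p)" using p by simp
  have p0: "0 < int p" using prime_gt_0_nat[OF p] by simp
  have cancel: "[x = y] (mod int p)" if "[z * x = z * y] (mod int p)" "\<not> int p dvd z" for x y z
  proof -
    have "int p dvd z * (x - y)" using that(1) by (simp add: cong_iff_dvd_diff algebra_simps)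
    thus ?thesis using that(2) prime_p by (simp add: prime_dvd_mult_iff cong_iff_dvd_diff)
  qed
  have not_dvd: "\<not> int p dvd x" if "x \<in> I" for x
    using that I zdvd_not_zless[of x "int p"] by force
  have \<Omega>: "card \<Omega> \<le> k"
  proof -
    have "card {\<omega> \<in> {0..<int p}. [poly (monom 1 k) \<omega> = \<mu>] (mod int p)} \<le> degree (monom (1 :: int) k)"
      using p k prime_gt_1_nat[OF p] by (intro card_poly_fibres_mod_prime_le[where i = k]) auto
    moreover have "card \<Omega> \<le> card {\<omega> \<in> {0..<int p}. [poly (monom 1 k) \<omega> = \<mu>] (mod int p)}"
    proof (rule card_mono)
      show "\<Omega> \<subseteq> {\<omega> \<in> {0..<int p}. [poly (monom 1 k) \<omega> = \<mu>] (mod int p)}"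
        by (auto simp: \<Omega>_def poly_monom)
    qed (rule finite_subset[of _ "{0..<int p}"], auto)
    ultimately show ?thesis by (simp add: degree_monom_eq)
  qed
  have R: "card (R \<omega>) \<le> degree f" if \<omega>: "\<omega> \<in> \<Omega>" for \<omega>
  proof -
    have w: "[\<omega> ^ k = \<mu>] (mod int p)" "\<not> [\<omega> ^ l = 1] (mod int p)" "\<not> int p dvd \<omega>"
      using \<omega> by (auto simp: \<Omega>_def)
    have "\<not> [\<omega> ^ j = \<omega> ^ k] (mod int p)"
    proof
      assume eq: "[\<omega> ^ j = \<omega> ^ k] (mod int p)"
      from l have "[\<omega> ^ min j k * \<omega> ^ l = \<omega> ^ min j k * 1] (mod int p)"
      proof
        assume "j = k + l"
        thus ?thesis using eq by (simp add: power_add)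
      next
        assume "k = j + l"
        thus ?thesis using cong_sym[OF eq] by (simp add: power_add)
      qed
      moreover have "\<not> int p dvd \<omega> ^ min j k" using w(3) prime_p prime_dvd_power by blast
      ultimately show False using cancel w(2) by blast
    qed
    hence "\<not> [\<omega> ^ j = \<mu>] (mod int p)" using w(1) cong_sym cong_trans by blast
    hence "\<not> int p dvd coeff f j * (\<omega> ^ j - \<mu>)"
      using j prime_p by (simp add: prime_dvd_mult_iff cong_iff_dvd_diff)
    moreover have "coeff (h \<omega>) j = coeff f j * (\<omega> ^ j - \<mu>)"
      by (simp add: h_def coeff_pcompose_linear algebra_simps)
    ultimately have "card (R \<omega>) \<le> degree (h \<omega>)"
      unfolding R_def using j by (intro card_poly_fibres_mod_prime_le[OF p]) auto
    also have "degree (h \<omega>) \<le> degree f"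
      unfolding h_def
    proof (rule degree_diff_le)
      show "degree (pcompose f [:0, \<omega>:]) \<le> degree f"
        using degree_pcompose_le[of f "[:0, \<omega>:]"] by (cases "\<omega> = 0") auto
    qed (rule degree_smult_le)
    finally show ?thesis .
  qed
  have fin: "finite \<Omega>" "finite (R \<omega>)" for \<omega>
    by (rule finite_subset[of _ "{0..<int p}"]; auto simp: \<Omega>_def R_def)+
  have "?P \<subseteq> (\<lambda>(\<omega>, x). (x, \<omega> * x mod int p)) ` (SIGMA \<omega>:\<Omega>. R \<omega>)"
  proof
    fix q assume "q \<in> ?P"
    then obtain x x' where q: "q = (x, x')" and x: "x \<in> I" "x' \<in> I" "\<not> [x' ^ l = x ^ l] (mod int p)"
      "[x' ^ k = \<mu> * x ^ k] (mod int p)" "[poly f x' = \<mu> * poly f x + \<gamma>] (mod int p)" by auto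
    have "coprime (int p) x" using not_dvd[OF x(1)] prime_p by (intro prime_imp_coprime)
    then obtain y where y: "[x * y = 1] (mod int p)"
      using cong_solve_coprime_int[of x "int p"] by (auto simp: coprime_commute)
    \<comment> \<open>the quotient of \<open>x'\<close> by \<open>x\<close>\<close>
    define \<omega> where "\<omega> = x' * y mod int p"
    have "[\<omega> = x' * y] (mod int p)" by (simp add: \<omega>_def)
    hence "[\<omega> * x = x' * y * x] (mod int p)" by (intro cong_mult) auto
    also have "x' * y * x = x' * (x * y)" by simp
    also have "[x' * (x * y) = x' * 1] (mod int p)" using y by (intro cong_mult) auto
    finally have wx: "[\<omega> * x = x'] (mod int p)" by simp
    have wpow: "[\<omega> ^ n * x ^ n = x' ^ n] (mod int p)" for n
      using cong_pow[OF wx, of n] by (simp add: power_mult_distrib)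
    have xpow: "\<not> int p dvd x ^ n" for n using not_dvd[OF x(1)] prime_p prime_dvd_power by blast
    have "[x ^ k * \<omega> ^ k = x ^ k * \<mu>] (mod int p)"
      using cong_trans[OF wpow[of k] x(4)] by (simp add: mult.commute)
    hence 1: "[\<omega> ^ k = \<mu>] (mod int p)" using cancel xpow by blast
    have 2: "\<not> [\<omega> ^ l = 1] (mod int p)"
    proof
      assume "[\<omega> ^ l = 1] (mod int p)"
      hence "[\<omega> ^ l * x ^ l = 1 * x ^ l] (mod int p)" by (intro cong_mult) auto
      from cong_trans[OF cong_sym[OF wpow[of l]] this] show False using x(3) by simp
    qed
    have 3: "\<not> int p dvd \<omega>"
    proof
      assume "int p dvd \<omega>"
      hence "int p dvd \<omega> * x" by simp
      hence "int p dvd x'" using wx cong_dvd_iff[of "\<omega> * x" x' "int p"] by blast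
      thus False using not_dvd[OF x(2)] by simp
    qed
    have "\<omega> \<in> \<Omega>" using 1 2 3 p0 by (auto simp: \<Omega>_def \<omega>_def)
    moreover have "[poly f (\<omega> * x) = \<mu> * poly f x + \<gamma>] (mod int p)"
      by (rule cong_trans[OF poly_cong_int[OF wx] x(5)])
    from cong_diff[OF this cong_refl[of "\<mu> * poly f x"]]
    have "[poly (h \<omega>) x = \<gamma>] (mod int p)" by (simp add: h_def poly_pcompose mult.commute)
    hence "x \<in> R \<omega>" using x(1) I by (auto simp: R_def)
    moreover have "\<omega> * x mod int p = x'" using wx x(2) I by (auto simp: cong_def)
    ultimately show "q \<in> (\<lambda>(\<omega>, x). (x, \<omega> * x mod int p)) ` (SIGMA \<omega>:\<Omega>. R \<omega>)"
      using q by (intro image_eqI[of _ _ "(\<omega>, x)"]) auto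
  qed
  hence "card ?P \<le> card (SIGMA \<omega>:\<Omega>. R \<omega>)"
    using fin by (intro surj_card_le) auto
  also have "\<dots> = (\<Sum>\<omega>\<in>\<Omega>. card (R \<omega>))" using fin by (intro card_SigmaI) auto
  also have "\<dots> \<le> (\<Sum>\<omega>\<in>\<Omega>. degree f)" by (intro sum_mono R)
  also have "\<dots> \<le> k * degree f" using \<Omega> by simp
  finally show ?thesis .
qed

section \<open>Growth and the expander property\<close>

text \<open>
  Apply \<open>affine_family_growth\<close> to the maps \<open>y \<mapsto> f(x) + x\<^sup>k y\<close> for \<open>x\<close> in \<open>A - {0}\<close> and to the values of
  \<open>g\<close> on \<open>B\<close>. The bounds on roots modulo \<open>p\<close> show that there are about as many of these values
  as elements of \<open>B\<close> and that the image set is not much smaller than \<open>A\<close>. The factor \<open>D\<^sup>2\<close> absorbs all constants.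
\<close>

lemma growth_mod_prime:
  fixes f g :: "int poly" and k j l p :: nat and A B :: "int set" and L :: real
  defines "D \<equiv> real (2 + degree f + k + degree g + l + k * degree f)"
    and "V \<equiv> (\<lambda>(x, y). (poly f x + x ^ k * poly g y) mod int p) ` (A \<times> B)"
  assumes p: "prime p" and k: "0 < k" and j: "0 < j" "\<not> int p dvd coeff f j"
    and l: "0 < l" "j = k + l \<or> k = j + l" and g: "0 < degree g" "\<not> int p dvd lead_coeff g"
    and A: "A \<subseteq> {0..<int p}" and B: "B \<subseteq> {0..<int p}"
    and L: "0 < L" "L \<le> real (card A)" "L \<le> real (card B)" and A2: "2 \<le> card A"
  shows "L \<le> D * real (card V) \<and>
    (real (card V) \<le> (D\<^sup>2 * real (card V) / L) ^ 700000 \<or>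
     real p \<le> (D\<^sup>2 * real (card V) / L) ^ 700000 * real (card V))"
proof -
  interpret prime_field_in_ring "range (residue p)" "residue p 1"
    using p by (rule prime_field_residue)
  have p0: "0 < p" using p by (rule prime_gt_0_nat)
  define R where "R = residue p"
  define I where "I = A - {0}"
  define bad where "bad = (\<lambda>x x'. [x' ^ l = x ^ l] (mod int p))"
  define M where "M = real (card V)"
  define K where "K = D\<^sup>2 * M / L"
  have fin: "finite A" "finite B" "finite V"
    using finite_subset[OF A] finite_subset[OF B] by (simp_all add: V_def)
  have D2: "2 \<le> D" by (simp add: D_def)
  have D1: "0 < D" using D2 by simp
  have injR: "inj_on R {0..<int p}"
    by (auto simp: R_def inj_on_def residue_eq_iff cong_def)
  have Vp: "V \<subseteq> {0..<int p}" using p0 by (auto simp: V_def)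
  define U where "U = R ` V"
  have cU: "card U = card V"
    unfolding U_def using injR Vp by (intro card_image) (rule inj_on_subset)
  define Y where "Y = (\<lambda>y. R (poly g y)) ` B"
  have "B \<noteq> {}" using L by auto
  then obtain y0 where y0: "y0 \<in> B" by blast
  have AV: "real (card A) \<le> D * M"
  proof -
    \<comment> \<open>already the values at a single \<open>y0\<close> are about as many as the elements of \<open>A\<close>\<close>
    define h where "h = f + monom (poly g y0) k"
    have "coeff h j = coeff f j" using l by (auto simp: h_def)
    have "card A \<le> degree h * card ((\<lambda>x. poly h x mod int p) ` A)"
    proof (rule card_le_fibres[OF fin(1)])
      fix u assume "u \<in> (\<lambda>x. poly h x mod int p) ` A"
      hence "{x \<in> A. poly h x mod int p = u} = {x \<in> A. [poly h x = u] (mod int p)}"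
        by (auto simp: cong_def)
      thus "card {x \<in> A. poly h x mod int p = u} \<le> degree h"
        using card_poly_fibres_mod_prime_le[OF p j(1) _ A, of h u] j \<open>coeff h j = coeff f j\<close> by simp
    qed
    also have "\<dots> \<le> degree h * card V"
    proof (intro mult_left_mono card_mono)
      show "(\<lambda>x. poly h x mod int p) ` A \<subseteq> V"
      proof
        fix u assume "u \<in> (\<lambda>x. poly h x mod int p) ` A"
        then obtain x where x: "x \<in> A" "u = poly h x mod int p" by blast
        have "u = (poly f x + x ^ k * poly g y0) mod int p"
          by (simp add: x h_def poly_monom mult.commute)
        thus "u \<in> V" using x y0 unfolding V_def by (intro image_eqI[of _ _ "(x, y0)"]) auto
      qed
    qed (use fin in auto)
    finally have "real (card A) \<le> real (degree h) * M" by (simp add: M_def flip: of_nat_mult)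
    also have "\<dots> \<le> D * M"
    proof (intro mult_right_mono)
      have "degree h \<le> max (degree f) k"
        unfolding h_def using degree_add_le_max[of f "monom (poly g y0) k"] degree_monom_le[of "poly g y0" k]
        by linarith
      hence "degree h \<le> 2 + degree f + k + degree g + l + k * degree f" by linarith
      thus "real (degree h) \<le> D" unfolding D_def by (rule of_nat_mono)
    qed (simp add: M_def)
    finally show ?thesis .
  qed
  hence LM: "L \<le> D * M" using L by linarith
  hence "0 < D * M" using L by linarith
  hence M0: "0 < M" using D1 by (rule zero_less_mult_pos)
  have KD: "D \<le> K"
  proof -
    have "D * L \<le> D * (D * M)" using LM D1 by (intro mult_left_mono) auto
    thus ?thesis using L by (simp add: K_def pos_le_divide_eq power2_eq_square mult.assoc)
  qed
  have MK: "M / K = L / D\<^sup>2" using M0 D1 L by (simp add: K_def)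
  have DD: "2 * D \<le> D\<^sup>2" using mult_right_mono[OF D2, of D] D1 by (simp add: power2_eq_square)
  have cY: "L / D\<^sup>2 \<le> real (card Y)"
  proof -
    have "card B \<le> degree g * card Y"
      unfolding Y_def
    proof (rule card_le_fibres[OF fin(2)])
      fix u assume "u \<in> (\<lambda>y. R (poly g y)) ` B"
      then obtain y where "u = R (poly g y)" by blast
      hence "{x \<in> B. R (poly g x) = u} = {x \<in> B. [poly g x = poly g y] (mod int p)}"
        by (auto simp: R_def residue_eq_iff)
      thus "card {x \<in> B. R (poly g x) = u} \<le> degree g"
        using card_poly_fibres_mod_prime_le[OF p g B] by simp
    qed
    hence "real (card B) \<le> real (degree g) * real (card Y)" by (simp flip: of_nat_mult)
    also have "\<dots> \<le> D\<^sup>2 * real (card Y)"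
    proof (intro mult_right_mono)
      have "real (degree g) \<le> D" by (simp add: D_def)
      thus "real (degree g) \<le> D\<^sup>2" using DD D1 by linarith
    qed simp
    finally have "L \<le> D\<^sup>2 * real (card Y)" using L by linarith
    thus ?thesis using D1 by (simp add: pos_divide_le_eq mult.commute)
  qed
  have cI: "real (card A) - 1 \<le> real (card I)" "real (card I) \<le> real (card A)"
    using fin(1) by (auto simp: I_def card_Diff_singleton_if)
  have not_dvd: "\<not> int p dvd x" if "x \<in> I" for x
  proof -
    have "x \<in> {0..<int p}" "x \<noteq> 0" using that A by (auto simp: I_def)
    thus ?thesis by (intro zdvd_not_zless) auto
  qed
  have "M \<le> K ^ 700000 \<or> real (card (range (residue p))) \<le> K ^ 700000 * M"
    unfolding M_def cU[symmetric]
  proof (rule affine_family_growth[where I = I and Y = Y and a = "\<lambda>x. R (x ^ k)" and b = "\<lambda>x. R (poly f x)"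
        and bad = bad])
    show "U \<subseteq> range (residue p)" "Y \<subseteq> range (residue p)" by (auto simp: U_def Y_def R_def)
    show "finite I" using fin by (simp add: I_def)
    show "R (x ^ k) \<in> range (residue p) - {0}" if x: "x \<in> I" for x
    proof -
      have "prime (int p)" using p by simp
      hence "\<not> int p dvd x ^ k" using not_dvd[OF x] prime_dvd_power by blast
      thus ?thesis by (simp add: R_def residue_eq_0_iff)
    qed
    show "R (poly f x) \<in> range (residue p)" for x by (simp add: R_def)
    show "R (poly f x) + R (x ^ k) * y \<in> U" if xy: "x \<in> I" "y \<in> Y" for x y
    proof -
      obtain z where z: "z \<in> B" "y = R (poly g z)" using xy by (auto simp: Y_def)
      have "R (poly f x) + R (x ^ k) * y = R ((poly f x + x ^ k * poly g z) mod int p)"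
        by (simp add: z R_def residue_mod residue_add residue_mult)
      moreover have "(poly f x + x ^ k * poly g z) mod int p \<in> V"
        unfolding V_def using xy z by (intro image_eqI[of _ _ "(x, z)"]) (auto simp: I_def)
      ultimately show ?thesis by (simp add: U_def)
    qed
    show "2 \<le> K" using D2 KD by linarith
    show "real (card U) / K \<le> real (card I)"
    proof -
      have "L \<le> 2 * real (card I)" using L cI A2 by linarith
      also have "\<dots> \<le> D\<^sup>2 * real (card I)" using DD D2 by (intro mult_right_mono) auto
      finally have "L / D\<^sup>2 \<le> real (card I)" using D1 by (simp add: pos_divide_le_eq mult.commute)
      thus ?thesis using MK by (simp add: cU M_def)
    qed
    show "real (card I) \<le> K * real (card U)"
    proof -
      have "D * M \<le> K * M" using KD M0 by (intro mult_right_mono) auto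
      hence "real (card I) \<le> K * M" using cI AV by linarith
      thus ?thesis by (simp add: cU M_def)
    qed
    show "real (card U) / K \<le> real (card Y)" using cY MK by (simp add: cU M_def)
    show "real (card {x' \<in> I. bad x x'}) \<le> K" for x
    proof -
      have "card {x' \<in> I. [poly (monom 1 l) x' = x ^ l] (mod int p)} \<le> degree (monom (1 :: int) l)"
        using l prime_gt_1_nat[OF p] A
        by (intro card_poly_fibres_mod_prime_le[OF p, where i = l]) (auto simp: I_def)
      hence "card {x' \<in> I. bad x x'} \<le> l" by (simp add: bad_def poly_monom degree_monom_eq)
      hence "card {x' \<in> I. bad x x'} \<le> 2 + degree f + k + degree g + l + k * degree f" by linarith
      hence "real (card {x' \<in> I. bad x x'}) \<le> D" unfolding D_def by (rule of_nat_mono)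
      thus ?thesis using KD by linarith
    qed
    show "real (card {(x, x') \<in> I \<times> I. \<not> bad x x' \<and> R (x' ^ k) = m * R (x ^ k) \<and>
            R (poly f x') = m * R (poly f x) + c}) \<le> K"
      if mc: "m \<in> range (residue p)" "c \<in> range (residue p)" for m c
    proof -
      obtain \<mu> \<gamma> where \<mu>: "m = R \<mu>" "c = R \<gamma>" using mc by (auto simp: R_def)
      have "I \<subseteq> {1..<int p}" using A by (auto simp: I_def)
      from card_coincident_lines_le[OF p k j l(2) this, of \<mu> \<gamma>]
      have "card {(x, x') \<in> I \<times> I. \<not> bad x x' \<and> R (x' ^ k) = m * R (x ^ k) \<and>
              R (poly f x') = m * R (poly f x) + c} \<le> k * degree f"
        by (simp add: bad_def \<mu> R_def residue_eq_iff flip: residue_mult residue_add)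
      hence "real (card {(x, x') \<in> I \<times> I. \<not> bad x x' \<and> R (x' ^ k) = m * R (x ^ k) \<and>
              R (poly f x') = m * R (poly f x) + c}) \<le> real (k * degree f)" by (rule of_nat_mono)
      also have "\<dots> \<le> D" by (simp add: D_def)
      finally show ?thesis using KD by linarith
    qed
  qed
  hence "M \<le> K ^ 700000 \<or> real p \<le> K ^ 700000 * M" unfolding card_range_residue[OF p0] .
  thus ?thesis using LM unfolding K_def M_def by blast
qed

text \<open>
  With \<open>K\<close> the ratio of \<open>M\<close> to \<open>P\<^sup>\<alpha>\<close> up to a constant, both alternatives of \<open>growth\<close> force \<open>K\<close> to be at
  least a small constant times \<open>P\<^sup>\<epsilon>\<close>: the first because \<open>M\<close> is at least of order \<open>P\<^sup>\<alpha>\<close>, the second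
  because \<open>P\<close> exceeds \<open>P\<^sup>\<alpha>\<close> by the factor \<open>P\<^bsup>1 - \<alpha>\<^esup>\<close>. The constant \<open>c\<close> depends on \<open>L\<close> and \<open>D\<close> but
  not on \<open>\<alpha>\<close>.
\<close>

lemma exponent_gain:
  fixes P \<alpha> \<epsilon> c \<eta> L D M :: real and C :: nat
  assumes P: "1 \<le> P" and C: "0 < C" and \<epsilon>: "0 < \<epsilon>" "(real C + 1) * \<epsilon> \<le> \<alpha>" "(real C + 1) * \<epsilon> \<le> 1 - \<alpha>"
    and L: "0 < L" and D: "0 < D" and M: "0 < M" "L * P powr \<alpha> \<le> D * M"
    and \<eta>: "0 < \<eta>" "\<eta> \<le> 1" "\<eta> \<le> L / D" and c: "0 < c" "c \<le> 1" "D\<^sup>2 * c \<le> \<eta> * L"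
    and growth: "M \<le> (D\<^sup>2 * M / (L * P powr \<alpha>)) ^ C \<or> P \<le> (D\<^sup>2 * M / (L * P powr \<alpha>)) ^ C * M"
  shows "c * P powr (\<alpha> + \<epsilon>) \<le> M"
proof (rule ccontr)
  assume "\<not> ?thesis"
  hence less: "M < c * P powr (\<alpha> + \<epsilon>)" by simp
  define K where "K = D\<^sup>2 * M / (L * P powr \<alpha>)"
  have Pp: "0 < P powr x" for x using P by simp
  have "D\<^sup>2 * M < D\<^sup>2 * (c * P powr (\<alpha> + \<epsilon>))" using less D by (intro mult_strict_left_mono) auto
  also have "\<dots> \<le> \<eta> * L * P powr (\<alpha> + \<epsilon>)"
    using mult_right_mono[OF c(3) less_imp_le[OF Pp], of "\<alpha> + \<epsilon>"] by (simp add: mult.assoc)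
  also have "\<dots> = (\<eta> * P powr \<epsilon>) * (L * P powr \<alpha>)" by (simp add: powr_add)
  finally have K: "K < \<eta> * P powr \<epsilon>" using L Pp[of \<alpha>] by (simp add: K_def divide_less_eq)
  have K0: "0 < K" using D M L Pp[of \<alpha>] by (simp add: K_def)
  have "K ^ C < (\<eta> * P powr \<epsilon>) ^ C" using K K0 C by (intro power_strict_mono) auto
  also have "\<dots> = \<eta> ^ C * P powr (real C * \<epsilon>)"
    using P by (simp add: power_mult_distrib powr_power mult.commute)
  also have "\<dots> \<le> \<eta> * P powr (real C * \<epsilon>)"
    using \<eta> C power_decreasing[of 1 C \<eta>] Pp by (intro mult_right_mono) auto
  finally have KC: "K ^ C < \<eta> * P powr (real C * \<epsilon>)" .
  from growth show False
  proof
    assume "M \<le> (D\<^sup>2 * M / (L * P powr \<alpha>)) ^ C"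
    hence "M < \<eta> * P powr (real C * \<epsilon>)" using KC by (simp add: K_def)
    also have "\<dots> \<le> L / D * P powr \<alpha>"
      using P \<epsilon> \<eta> L D by (intro mult_mono powr_mono) (auto simp: algebra_simps)
    also have "\<dots> \<le> M" using M D by (simp add: field_simps)
    finally show False by simp
  next
    assume "P \<le> (D\<^sup>2 * M / (L * P powr \<alpha>)) ^ C * M"
    also have "\<dots> < (\<eta> * P powr (real C * \<epsilon>)) * (c * P powr (\<alpha> + \<epsilon>))"
      using KC less K0 M \<eta>(1) Pp unfolding K_def[symmetric] by (intro mult_strict_mono) auto
    also have "\<dots> = (\<eta> * c) * P powr (real C * \<epsilon> + (\<alpha> + \<epsilon>))" by (simp add: powr_add)
    also have "\<dots> \<le> 1 * P powr 1"
      using P \<epsilon> \<eta> c by (intro mult_mono powr_mono) (auto simp: algebra_simps mult_le_one)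
    finally show False using P by simp
  qed
qed

lemma not_affine_coeff:
  assumes "0 < k" "affinely_independent f (monom 1 k)"
  shows "\<exists>j. 0 < j \<and> j \<noteq> k \<and> coeff f j \<noteq> 0"
proof (rule ccontr)
  assume none: "\<not> ?thesis"
  have "f = smult (coeff f k) (monom 1 k) + [:coeff f 0:]"
  proof (rule poly_eqI)
    fix n
    show "coeff f n = coeff (smult (coeff f k) (monom 1 k) + [:coeff f 0:]) n"
      using none assms(1) by (cases n) auto
  qed
  thus False using assms(2) unfolding affinely_independent_def by blast
qed

lemma card_image_PiE_ge:
  fixes A :: "nat \<Rightarrow> 'a set"
  assumes "finite (A 0)" "finite (A 1)"
  shows "card ((\<lambda>(x, y). h x y) ` (A 0 \<times> A 1)) \<le> card ((\<lambda>a. h (a 0) (a 1)) ` Pi\<^sub>E {..<2} A)"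
proof (rule card_mono)
  have "finite (A i)" if "i < 2" for i :: nat using that assms by (cases i) auto
  thus "finite ((\<lambda>a. h (a 0) (a 1)) ` Pi\<^sub>E {..<2} A)" by (intro finite_imageI finite_PiE) auto
  show "(\<lambda>(x, y). h x y) ` (A 0 \<times> A 1) \<subseteq> (\<lambda>a. h (a 0) (a 1)) ` Pi\<^sub>E {..<2} A"
  proof clarify
    fix x y assume xy: "x \<in> A 0" "y \<in> A 1"
    define a where "a = (\<lambda>i\<in>{..<2 :: nat}. if i = 0 then x else y)"
    have "a i \<in> A i" if "i < 2" for i :: nat using that xy by (cases i) (auto simp: a_def)
    hence "a \<in> Pi\<^sub>E {..<2} A" by (auto simp: a_def PiE_iff extensional_def)
    moreover have "h x y = h (a 0) (a 1)" by (simp add: a_def)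
    ultimately show "h x y \<in> (\<lambda>a. h (a 0) (a 1)) ` Pi\<^sub>E {..<2} A" by blast
  qed
qed

theorem theorem4:
  fixes k :: nat and f g :: "int poly"
  assumes "k \<ge> 1"
    and "degree g > 0"
    and "affinely_independent f (monom 1 k)"
  shows "induces_expander 2 (\<lambda>a. poly f (a 0) + a 0 ^ k * poly g (a 1))"
proof -
  have k0: "0 < k" using assms by simp
  obtain j where j: "0 < j" "j \<noteq> k" "coeff f j \<noteq> 0"
    using not_affine_coeff[OF k0 assms(3)] by blast
  define l where "l = (if j < k then k - j else j - k)"
  have l: "0 < l" "j = k + l \<or> k = j + l" using j by (auto simp: l_def)
  define D where "D = real (2 + degree f + k + degree g + l + k * degree f)"
  define p0 where "p0 = \<bar>coeff f j\<bar> + \<bar>lead_coeff g\<bar>"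
  define C :: nat where "C = 700000"
  define \<epsilon> :: "real \<Rightarrow> real" where "\<epsilon> = (\<lambda>\<alpha>. min \<alpha> (1 - \<alpha>) / (real C + 1))"
  have D2: "2 \<le> D" by (simp add: D_def)
  have lg: "lead_coeff g \<noteq> 0" using assms(2) by auto
  have p01: "1 \<le> p0" using j lg by (simp add: p0_def)
  show ?thesis
    unfolding induces_expander_def expander_def
  proof (intro exI[of _ \<epsilon>] conjI allI impI)
    show "0 < \<epsilon> \<alpha>" if "0 < \<alpha> \<and> \<alpha> < 1" for \<alpha> using that by (simp add: \<epsilon>_def)
    fix L1 L2 :: real assume L: "0 < L1 \<and> L1 \<le> L2"
    define \<eta> where "\<eta> = min 1 (L1 / D)"
    define c where "c = min (min 1 (\<eta> * L1 / D\<^sup>2)) (min (L1\<^sup>2) (1 / real_of_int p0))"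
    have \<eta>: "0 < \<eta>" "\<eta> \<le> 1" "\<eta> \<le> L1 / D" using L D2 by (auto simp: \<eta>_def)
    have c: "0 < c" "c \<le> 1" "c \<le> \<eta> * L1 / D\<^sup>2" "c \<le> L1\<^sup>2" "c \<le> 1 / real_of_int p0"
      using L D2 \<eta> p01 by (auto simp: c_def)
    show "\<exists>c>0. \<forall>\<alpha>. 0 < \<alpha> \<and> \<alpha> < 1 \<longrightarrow> (\<forall>p. prime p \<longrightarrow> (\<forall>A.
        (\<forall>i<2. A i \<subseteq> carrier (residue_ring (int p)) \<and> L1 * real p powr \<alpha> \<le> real (card (A i)) \<and>
          real (card (A i)) \<le> L2 * real p powr \<alpha>) \<longrightarrow>
        c * real p powr (\<alpha> + \<epsilon> \<alpha>) \<le> real (card (induced_map (\<lambda>a. poly f (a 0) + a 0 ^ k * poly g (a 1)) p ` Pi\<^sub>E {..<2} A))))"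
    proof (intro exI[of _ c] conjI allI impI)
      fix \<alpha> :: real and p :: nat and A :: "nat \<Rightarrow> int set"
      assume \<alpha>: "0 < \<alpha> \<and> \<alpha> < 1" and p: "prime p"
        and A: "\<forall>i<2. A i \<subseteq> carrier (residue_ring (int p)) \<and> L1 * real p powr \<alpha> \<le> real (card (A i)) \<and>
          real (card (A i)) \<le> L2 * real p powr \<alpha>"
      have P: "1 \<le> real p" using prime_gt_1_nat[OF p] by simp
      have Asub: "A 0 \<subseteq> {0..<int p}" "A 1 \<subseteq> {0..<int p}"
        using A[rule_format, of 0] A[rule_format, of 1] by (auto simp: residue_ring_def)
      have Acard: "L1 * real p powr \<alpha> \<le> real (card (A 0))" "L1 * real p powr \<alpha> \<le> real (card (A 1))"
        using A[rule_format, of 0] A[rule_format, of 1] by auto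
      have Lp: "0 < L1 * real p powr \<alpha>" using L P by simp
      have fA: "finite (A 0)" "finite (A 1)" using Asub finite_subset by auto
      have ne: "A 0 \<noteq> {}" "A 1 \<noteq> {}" using Acard Lp by auto
      define V where "V = (\<lambda>(x, y). (poly f x + x ^ k * poly g y) mod int p) ` (A 0 \<times> A 1)"
      have V0: "0 < card V" using fA ne by (auto simp: V_def card_gt_0_iff)
      have \<epsilon>: "0 < \<epsilon> \<alpha>" "(real C + 1) * \<epsilon> \<alpha> \<le> \<alpha>" "(real C + 1) * \<epsilon> \<alpha> \<le> 1 - \<alpha>" "\<epsilon> \<alpha> \<le> \<alpha>" "\<epsilon> \<alpha> \<le> 1 - \<alpha>"
        using \<alpha> by (auto simp: \<epsilon>_def C_def)
      have "c * real p powr (\<alpha> + \<epsilon> \<alpha>) \<le> real (card V)"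
      \<comment> \<open>for small primes or a singleton set, the required lower bound is at most \<open>1\<close>\<close>
      proof (cases "int p \<le> p0 \<or> card (A 0) < 2")
        case True
        have "c * real p powr (\<alpha> + \<epsilon> \<alpha>) \<le> 1"
          using True
        proof
          assume "int p \<le> p0"
          hence "real p \<le> real_of_int p0" by linarith
          moreover have "real p powr (\<alpha> + \<epsilon> \<alpha>) \<le> real p powr 1" using P \<epsilon> by (intro powr_mono) auto
          ultimately have "c * real p powr (\<alpha> + \<epsilon> \<alpha>) \<le> 1 / real_of_int p0 * real_of_int p0"
            using c P by (intro mult_mono) auto
          thus ?thesis using p01 by simp
        next
          assume "card (A 0) < 2"
          hence "L1 * real p powr \<alpha> \<le> 1" using Acard by linarith
          hence "(L1 * real p powr \<alpha>)\<^sup>2 \<le> 1" using Lp by (intro power_le_one) auto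
          moreover have "real p powr (\<alpha> + \<epsilon> \<alpha>) \<le> real p powr (\<alpha> + \<alpha>)" using P \<epsilon> by (intro powr_mono) auto
          hence "c * real p powr (\<alpha> + \<epsilon> \<alpha>) \<le> L1\<^sup>2 * real p powr (\<alpha> + \<alpha>)"
            using c by (intro mult_mono) auto
          moreover have "L1\<^sup>2 * real p powr (\<alpha> + \<alpha>) = (L1 * real p powr \<alpha>)\<^sup>2"
            by (simp only: powr_add power2_eq_square mult_ac)
          ultimately show ?thesis by linarith
        qed
        thus ?thesis using V0 by linarith
      next
        case False
        have nd: "\<not> int p dvd x" if "x \<noteq> 0" "\<bar>x\<bar> \<le> p0" for x
          using that False dvd_imp_le_int[of x "int p"] by auto
        have "L1 * real p powr \<alpha> \<le> D * real (card V) \<and>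
            (real (card V) \<le> (D\<^sup>2 * real (card V) / (L1 * real p powr \<alpha>)) ^ 700000 \<or>
             real p \<le> (D\<^sup>2 * real (card V) / (L1 * real p powr \<alpha>)) ^ 700000 * real (card V))"
          unfolding D_def V_def using False j lg Asub Lp Acard l assms(2)
          by (intro growth_mod_prime[OF p k0 j(1)] nd) (auto simp: p0_def)
        thus ?thesis
          using V0 c D2 L by (intro exponent_gain[where C = C and \<eta> = \<eta> and L = L1 and D = D] P \<epsilon> \<eta>)
            (auto simp: C_def field_simps)
      qed
      also have "card V \<le> card (induced_map (\<lambda>a. poly f (a 0) + a 0 ^ k * poly g (a 1)) p ` Pi\<^sub>E {..<2} A)"
        unfolding V_def induced_map_def
        by (rule card_image_PiE_ge[of A "\<lambda>x y. (poly f x + x ^ k * poly g y) mod int p", OF fA])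
      finally show "c * real p powr (\<alpha> + \<epsilon> \<alpha>)
          \<le> real (card (induced_map (\<lambda>a. poly f (a 0) + a 0 ^ k * poly g (a 1)) p ` Pi\<^sub>E {..<2} A))"
        by simp
    qed (rule c)
  qed
qed

end
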